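(* Let $\mathfrak{H}$ be a bicategorically complete 2-category, let $\mathcal{A},\mathcal{B}:\dot\Delta\to\mathfrak{H}$ be pseudofunctors and let $\alpha:\mathcal{A}\to\mathcal{B}$ be a pseudonatural transformation. If $\alpha$ is objectwise faithful and $\mathcal{B}$ is of almost $\mathrm{j}$-descent, then so is $\mathcal{A}$. Furthermore, if $\mathcal{B}$ is of $\mathrm{j}$-descent and $\alpha$ is objectwise fully faithful, then $\mathcal{A}$ is of $\mathrm{j}$-descent as well.
   Context: $\mathrm{j}:\Delta\to\dot\Delta$ is the full inclusion of the category of nonempty finite ordinals into the category of finite ordinals and order preserving functions (with $\mathsf{0}$ the empty ordinal), regarded as locally discrete 2-categories. $[-,-]_{PS}$ denotes 2-categories of pseudofunctors, pseudonatural transformations and modifications. $\mathfrak{H}$ is bicategorically complete if it has all small weighted bilimits: objects $\mathrm{bilim}(\mathcal{W},\mathcal{D})$ with equivalences $\mathfrak{H}(X,\mathrm{bilim}(\mathcal{W},\mathcal{D}))\simeq[\mathfrak{S},\mathsf{CAT}]_{PS}(\mathcal{W},\mathfrak{H}(X,\mathcal{D}-))$ pseudonatural in $X$. A 1-cell $f$ of $\mathfrak{H}$ is faithful/fully faithful if $\mathfrak{H}(X,f)$ is faithful/fully faithful for all objects $X$; a pseudonatural transformation is objectwise (fully) faithful if all its 1-cell components are. $\mathrm{PsRan}_{\mathrm{j}}$ denotes the right biadjoint of $-\circ\mathrm{j}:[\dot\Delta,\mathfrak{H}]_{PS}\to[\Delta,\mathfrak{H}]_{PS}$, with unit $\eta_{\mathcal{A}}:\mathcal{A}\to\mathrm{PsRan}_{\mathrm{j}}(\mathcal{A}\circ\mathrm{j})$.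 $\mathcal{A}:\dot\Delta\to\mathfrak{H}$ is of $\mathrm{j}$-descent (resp. almost $\mathrm{j}$-descent) if the component $\eta^{\mathsf{0}}_{\mathcal{A}}:\mathcal{A}(\mathsf{0})\to\mathrm{PsRan}_{\mathrm{j}}(\mathcal{A}\circ\mathrm{j})(\mathsf{0})$ is fully faithful (resp. faithful); here $\mathrm{PsRan}_{\mathrm{j}}(\mathcal{A}\circ\mathrm{j})(\mathsf{0})$ is the conical bilimit of $\mathcal{A}\circ\mathrm{j}$ (the bilimit weighted by the constant weight at the terminal category). *)

theory Defs
  imports "HOL-Library.FuncSet" "HOL-Library.Equipollence"
begin

text \<open>
  Categories and 2-categories are records whose cells live in arbitrary types, with explicit
  carriers. Composition is always written in the order of function application.  Functions that are
  part of a morphism (functors, pseudofunctors, transformations, modifications) are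
  \<^const>\<open>extensional\<close> on the relevant carriers, so that equality of records is equality of morphisms.
\<close>

section \<open>Categories\<close>

record ('o, 'a) cat =
  cobj :: "'o set"
  carr :: "'a set"
  cdom :: "'a \<Rightarrow> 'o"
  ccod :: "'a \<Rightarrow> 'o"
  cid :: "'o \<Rightarrow> 'a"
  ccomp :: "'a \<Rightarrow> 'a \<Rightarrow> 'a"

definition chom :: "('o, 'a) cat \<Rightarrow> 'o \<Rightarrow> 'o \<Rightarrow> 'a set" where
  "chom C x y = {h \<in> carr C. cdom C h = x \<and> ccod C h = y}"

locale category =
  fixes C :: "('o, 'a) cat"
  assumes dom_cod: "h \<in> carr C \<Longrightarrow> cdom C h \<in> cobj C \<and> ccod C h \<in> cobj C"
    and id_hom: "x \<in> cobj C \<Longrightarrow> cid C x \<in> chom C x x"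
    and comp_hom: "h \<in> chom C x y \<Longrightarrow> k \<in> chom C y z \<Longrightarrow> ccomp C k h \<in> chom C x z"
    and id_left: "h \<in> chom C x y \<Longrightarrow> ccomp C (cid C y) h = h"
    and id_right: "h \<in> chom C x y \<Longrightarrow> ccomp C h (cid C x) = h"
    and comp_assoc: "h \<in> chom C w x \<Longrightarrow> k \<in> chom C x y \<Longrightarrow> l \<in> chom C y z
      \<Longrightarrow> ccomp C (ccomp C l k) h = ccomp C l (ccomp C k h)"

record ('o, 'a) cfunctor =
  fsrc :: "('o, 'a) cat"
  ftgt :: "('o, 'a) cat"
  fobj :: "'o \<Rightarrow> 'o"
  farr :: "'a \<Rightarrow> 'a"

locale is_functor = src: category "fsrc F" + tgt: category "ftgt F"
  for F :: "('o, 'a) cfunctor" +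
  assumes obj_ext: "fobj F \<in> extensional (cobj (fsrc F))"
    and arr_ext: "farr F \<in> extensional (carr (fsrc F))"
    and obj_map: "x \<in> cobj (fsrc F) \<Longrightarrow> fobj F x \<in> cobj (ftgt F)"
    and arr_map: "h \<in> chom (fsrc F) x y \<Longrightarrow> farr F h \<in> chom (ftgt F) (fobj F x) (fobj F y)"
    and map_id: "x \<in> cobj (fsrc F) \<Longrightarrow> farr F (cid (fsrc F) x) = cid (ftgt F) (fobj F x)"
    and map_comp: "h \<in> chom (fsrc F) x y \<Longrightarrow> k \<in> chom (fsrc F) y z
      \<Longrightarrow> farr F (ccomp (fsrc F) k h) = ccomp (ftgt F) (farr F k) (farr F h)"

definition faithful_functor :: "('o, 'a) cfunctor \<Rightarrow> bool" where
  "faithful_functor F \<longleftrightarrow>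
     (\<forall>x\<in>cobj (fsrc F). \<forall>y\<in>cobj (fsrc F). inj_on (farr F) (chom (fsrc F) x y))"

definition full_functor :: "('o, 'a) cfunctor \<Rightarrow> bool" where
  "full_functor F \<longleftrightarrow>
     (\<forall>x\<in>cobj (fsrc F). \<forall>y\<in>cobj (fsrc F).
        farr F ` chom (fsrc F) x y = chom (ftgt F) (fobj F x) (fobj F y))"

record ('o, 'a) ctrans =
  tsrc :: "('o, 'a) cfunctor"
  ttgt :: "('o, 'a) cfunctor"
  tcomp :: "'o \<Rightarrow> 'a"

locale is_trans = src: is_functor "tsrc \<tau>" + tgt: is_functor "ttgt \<tau>"
  for \<tau> :: "('o, 'a) ctrans" +
  assumes same_src: "fsrc (ttgt \<tau>) = fsrc (tsrc \<tau>)"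
    and same_tgt: "ftgt (ttgt \<tau>) = ftgt (tsrc \<tau>)"
    and comp_ext: "tcomp \<tau> \<in> extensional (cobj (fsrc (tsrc \<tau>)))"
    and comp_map: "x \<in> cobj (fsrc (tsrc \<tau>))
      \<Longrightarrow> tcomp \<tau> x \<in> chom (ftgt (tsrc \<tau>)) (fobj (tsrc \<tau>) x) (fobj (ttgt \<tau>) x)"
    and natural: "h \<in> chom (fsrc (tsrc \<tau>)) x y
      \<Longrightarrow> ccomp (ftgt (tsrc \<tau>)) (farr (ttgt \<tau>) h) (tcomp \<tau> x)
        = ccomp (ftgt (tsrc \<tau>)) (tcomp \<tau> y) (farr (tsrc \<tau>) h)"


section \<open>2-categories\<close>

record ('o, 'a, 'c) twocat =
  Obj :: "'o set"
  Arr :: "'a set"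
  Cell :: "'c set"
  Dom :: "'a \<Rightarrow> 'o"
  Cod :: "'a \<Rightarrow> 'o"
  Src :: "'c \<Rightarrow> 'a"
  Tgt :: "'c \<Rightarrow> 'a"
  Id1 :: "'o \<Rightarrow> 'a"
  Id2 :: "'a \<Rightarrow> 'c"
  Comp1 :: "'a \<Rightarrow> 'a \<Rightarrow> 'a"  (infixr "\<odot>\<index>" 75)
  VComp :: "'c \<Rightarrow> 'c \<Rightarrow> 'c"  (infixr "\<cdot>\<index>" 65)
  HComp :: "'c \<Rightarrow> 'c \<Rightarrow> 'c"  (infixr "\<star>\<index>" 75)

definition Hom1 :: "('o, 'a, 'c) twocat \<Rightarrow> 'o \<Rightarrow> 'o \<Rightarrow> 'a set" where
  "Hom1 K X Y = {f \<in> Arr K. Dom K f = X \<and> Cod K f = Y}"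

definition Hom2 :: "('o, 'a, 'c) twocat \<Rightarrow> 'a \<Rightarrow> 'a \<Rightarrow> 'c set" where
  "Hom2 K f g = {\<sigma> \<in> Cell K. Src K \<sigma> = f \<and> Tgt K \<sigma> = g}"

definition Comps :: "('o, 'a, 'c) twocat \<Rightarrow> ('a \<times> 'a) set" where
  "Comps K = {(g, f). g \<in> Arr K \<and> f \<in> Arr K \<and> Dom K g = Cod K f}"

locale two_category =
  fixes K :: "('o, 'a, 'c) twocat"  (structure)
  assumes dom_cod: "f \<in> Arr K \<Longrightarrow> Dom K f \<in> Obj K \<and> Cod K f \<in> Obj K"
    and src_tgt: "\<sigma> \<in> Cell K \<Longrightarrow> Src K \<sigma> \<in> Arr K \<and> Tgt K \<sigma> \<in> Arr K
      \<and> Dom K (Src K \<sigma>) = Dom K (Tgt K \<sigma>) \<and> Cod K (Src K \<sigma>) = Cod K (Tgt K \<sigma>)"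
    and id1_hom: "X \<in> Obj K \<Longrightarrow> Id1 K X \<in> Hom1 K X X"
    and comp1_hom: "f \<in> Hom1 K X Y \<Longrightarrow> g \<in> Hom1 K Y Z \<Longrightarrow> g \<odot> f \<in> Hom1 K X Z"
    and comp1_id_left: "f \<in> Hom1 K X Y \<Longrightarrow> Id1 K Y \<odot> f = f"
    and comp1_id_right: "f \<in> Hom1 K X Y \<Longrightarrow> f \<odot> Id1 K X = f"
    and comp1_assoc: "f \<in> Hom1 K X Y \<Longrightarrow> g \<in> Hom1 K Y Z \<Longrightarrow> h \<in> Hom1 K Z V
      \<Longrightarrow> (h \<odot> g) \<odot> f = h \<odot> (g \<odot> f)"
    and id2_hom: "f \<in> Arr K \<Longrightarrow> Id2 K f \<in> Hom2 K f f"
    and vcomp_hom: "\<sigma> \<in> Hom2 K f g \<Longrightarrow> \<tau> \<in> Hom2 K g h \<Longrightarrow> \<tau> \<cdot> \<sigma> \<in> Hom2 K f h"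
    and vcomp_id_left: "\<sigma> \<in> Hom2 K f g \<Longrightarrow> Id2 K g \<cdot> \<sigma> = \<sigma>"
    and vcomp_id_right: "\<sigma> \<in> Hom2 K f g \<Longrightarrow> \<sigma> \<cdot> Id2 K f = \<sigma>"
    and vcomp_assoc: "\<sigma> \<in> Hom2 K f g \<Longrightarrow> \<tau> \<in> Hom2 K g h \<Longrightarrow> \<upsilon> \<in> Hom2 K h k
      \<Longrightarrow> (\<upsilon> \<cdot> \<tau>) \<cdot> \<sigma> = \<upsilon> \<cdot> (\<tau> \<cdot> \<sigma>)"
    and hcomp_hom: "f \<in> Hom1 K X Y \<Longrightarrow> g \<in> Hom1 K Y Z
      \<Longrightarrow> \<sigma> \<in> Hom2 K f f' \<Longrightarrow> \<tau> \<in> Hom2 K g g' \<Longrightarrow> \<tau> \<star> \<sigma> \<in> Hom2 K (g \<odot> f) (g' \<odot> f')"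
    and hcomp_id2: "f \<in> Hom1 K X Y \<Longrightarrow> g \<in> Hom1 K Y Z \<Longrightarrow> Id2 K g \<star> Id2 K f = Id2 K (g \<odot> f)"
    and interchange: "f \<in> Hom1 K X Y \<Longrightarrow> g \<in> Hom1 K Y Z
      \<Longrightarrow> \<sigma> \<in> Hom2 K f f' \<Longrightarrow> \<sigma>' \<in> Hom2 K f' f'' \<Longrightarrow> \<tau> \<in> Hom2 K g g' \<Longrightarrow> \<tau>' \<in> Hom2 K g' g''
      \<Longrightarrow> (\<tau>' \<cdot> \<tau>) \<star> (\<sigma>' \<cdot> \<sigma>) = (\<tau>' \<star> \<sigma>') \<cdot> (\<tau> \<star> \<sigma>)"
    and hcomp_id_left: "f \<in> Hom1 K X Y \<Longrightarrow> \<sigma> \<in> Hom2 K f f' \<Longrightarrow> Id2 K (Id1 K Y) \<star> \<sigma> = \<sigma>"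
    and hcomp_id_right: "f \<in> Hom1 K X Y \<Longrightarrow> \<sigma> \<in> Hom2 K f f' \<Longrightarrow> \<sigma> \<star> Id2 K (Id1 K X) = \<sigma>"
    and hcomp_assoc: "f \<in> Hom1 K X Y \<Longrightarrow> g \<in> Hom1 K Y Z \<Longrightarrow> h \<in> Hom1 K Z V
      \<Longrightarrow> \<sigma> \<in> Hom2 K f f' \<Longrightarrow> \<tau> \<in> Hom2 K g g' \<Longrightarrow> \<upsilon> \<in> Hom2 K h h'
      \<Longrightarrow> (\<upsilon> \<star> \<tau>) \<star> \<sigma> = \<upsilon> \<star> (\<tau> \<star> \<sigma>)"

definition inverse2 :: "('o, 'a, 'c) twocat \<Rightarrow> 'c \<Rightarrow> 'c \<Rightarrow> bool" where
  "inverse2 K \<sigma> \<tau> \<longleftrightarrow> \<sigma> \<in> Cell K \<and> \<tau> \<in> Hom2 K (Tgt K \<sigma>) (Src K \<sigma>)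
     \<and> \<tau> \<cdot>\<^bsub>K\<^esub> \<sigma> = Id2 K (Src K \<sigma>) \<and> \<sigma> \<cdot>\<^bsub>K\<^esub> \<tau> = Id2 K (Tgt K \<sigma>)"

definition iso2 :: "('o, 'a, 'c) twocat \<Rightarrow> 'c \<Rightarrow> bool" where
  "iso2 K \<sigma> \<longleftrightarrow> (\<exists>\<tau>. inverse2 K \<sigma> \<tau>)"

definition inv2 :: "('o, 'a, 'c) twocat \<Rightarrow> 'c \<Rightarrow> 'c" where
  "inv2 K \<sigma> = (THE \<tau>. inverse2 K \<sigma> \<tau>)"

definition equivalence1 :: "('o, 'a, 'c) twocat \<Rightarrow> 'a \<Rightarrow> bool" where
  "equivalence1 K f \<longleftrightarrow> f \<in> Arr K \<and>
     (\<exists>g\<in>Hom1 K (Cod K f) (Dom K f).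
        (\<exists>\<sigma>\<in>Hom2 K (g \<odot>\<^bsub>K\<^esub> f) (Id1 K (Dom K f)). iso2 K \<sigma>) \<and>
        (\<exists>\<tau>\<in>Hom2 K (f \<odot>\<^bsub>K\<^esub> g) (Id1 K (Cod K f)). iso2 K \<tau>))"

text \<open>Reversal of 1-cells only.\<close>

definition op1 :: "('o, 'a, 'c) twocat \<Rightarrow> ('o, 'a, 'c) twocat" where
  "op1 K = K\<lparr>Dom := Cod K, Cod := Dom K,
     Comp1 := (\<lambda>g f. f \<odot>\<^bsub>K\<^esub> g), HComp := (\<lambda>\<tau> \<sigma>. \<sigma> \<star>\<^bsub>K\<^esub> \<tau>)\<rparr>"

text \<open>The identity 2-cell on a 1-cell \<open>f\<close> is represented by \<open>f\<close> itself.\<close>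

definition locally_discrete :: "('o, 'a) cat \<Rightarrow> ('o, 'a, 'a) twocat" where
  "locally_discrete C =
     \<lparr>Obj = cobj C, Arr = carr C, Cell = carr C, Dom = cdom C, Cod = ccod C,
      Src = (\<lambda>f. f), Tgt = (\<lambda>f. f), Id1 = cid C, Id2 = (\<lambda>f. f),
      Comp1 = ccomp C, VComp = (\<lambda>\<tau> \<sigma>. \<sigma>), HComp = ccomp C\<rparr>"


section \<open>The 2-category of categories\<close>

definition functor_comp :: "('o, 'a) cfunctor \<Rightarrow> ('o, 'a) cfunctor \<Rightarrow> ('o, 'a) cfunctor" where
  "functor_comp G F =
     \<lparr>fsrc = fsrc F, ftgt = ftgt G,
      fobj = (\<lambda>x\<in>cobj (fsrc F). fobj G (fobj F x)),
      farr = (\<lambda>h\<in>carr (fsrc F). farr G (farr F h))\<rparr>"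

text \<open>
  All categories with objects in \<open>'o\<close> and arrows in \<open>'a\<close>; those of interest are reached by choosing
  the types large enough.
\<close>

definition CAT :: "(('o, 'a) cat, ('o, 'a) cfunctor, ('o, 'a) ctrans) twocat" where
  "CAT =
     \<lparr>Obj = {C. category C}, Arr = {F. is_functor F}, Cell = {\<tau>. is_trans \<tau>},
      Dom = fsrc, Cod = ftgt, Src = tsrc, Tgt = ttgt,
      Id1 = (\<lambda>C. \<lparr>fsrc = C, ftgt = C, fobj = (\<lambda>x\<in>cobj C. x), farr = (\<lambda>h\<in>carr C. h)\<rparr>),
      Id2 = (\<lambda>F. \<lparr>tsrc = F, ttgt = F, tcomp = (\<lambda>x\<in>cobj (fsrc F). cid (ftgt F) (fobj F x))\<rparr>),
      Comp1 = functor_comp,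
      VComp = (\<lambda>\<tau> \<sigma>. \<lparr>tsrc = tsrc \<sigma>, ttgt = ttgt \<tau>,
        tcomp = (\<lambda>x\<in>cobj (fsrc (tsrc \<sigma>)). ccomp (ftgt (tsrc \<sigma>)) (tcomp \<tau> x) (tcomp \<sigma> x))\<rparr>),
      HComp = (\<lambda>\<tau> \<sigma>. \<lparr>tsrc = functor_comp (tsrc \<tau>) (tsrc \<sigma>), ttgt = functor_comp (ttgt \<tau>) (ttgt \<sigma>),
        tcomp = (\<lambda>x\<in>cobj (fsrc (tsrc \<sigma>)).
          ccomp (ftgt (tsrc \<tau>)) (tcomp \<tau> (fobj (ttgt \<sigma>) x)) (farr (tsrc \<tau>) (tcomp \<sigma> x)))\<rparr>)\<rparr>"


section \<open>Pseudofunctors, pseudonatural transformations, modifications\<close>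

text \<open>
  The constraints of a pseudofunctor \<open>F\<close> are invertible 2-cells \<open>F g \<odot> F f \<Rightarrow> F (g \<odot> f)\<close>
  and \<open>Id (F X) \<Rightarrow> F (Id X)\<close>.
\<close>

record ('o, 'a, 'c, 'p, 'b, 'd) psfun =
  on_obj :: "'o \<Rightarrow> 'p"
  on_arr :: "'a \<Rightarrow> 'b"
  on_cell :: "'c \<Rightarrow> 'd"
  comp_con :: "'a \<times> 'a \<Rightarrow> 'd"
  unit_con :: "'o \<Rightarrow> 'd"

locale pseudofunctor = S: two_category S + H: two_category H
  for S :: "('o, 'a, 'c) twocat" and H :: "('p, 'b, 'd) twocat"
    and F :: "('o, 'a, 'c, 'p, 'b, 'd) psfun" +
  assumes obj_ext: "on_obj F \<in> extensional (Obj S)"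
    and arr_ext: "on_arr F \<in> extensional (Arr S)"
    and cell_ext: "on_cell F \<in> extensional (Cell S)"
    and comp_con_ext: "comp_con F \<in> extensional (Comps S)"
    and unit_con_ext: "unit_con F \<in> extensional (Obj S)"
    and obj_map: "X \<in> Obj S \<Longrightarrow> on_obj F X \<in> Obj H"
    and arr_map: "f \<in> Hom1 S X Y \<Longrightarrow> on_arr F f \<in> Hom1 H (on_obj F X) (on_obj F Y)"
    and cell_map: "\<sigma> \<in> Hom2 S f g \<Longrightarrow> on_cell F \<sigma> \<in> Hom2 H (on_arr F f) (on_arr F g)"
    and map_id2: "f \<in> Arr S \<Longrightarrow> on_cell F (Id2 S f) = Id2 H (on_arr F f)"
    and map_vcomp: "\<sigma> \<in> Hom2 S f g \<Longrightarrow> \<tau> \<in> Hom2 S g h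
      \<Longrightarrow> on_cell F (\<tau> \<cdot>\<^bsub>S\<^esub> \<sigma>) = on_cell F \<tau> \<cdot>\<^bsub>H\<^esub> on_cell F \<sigma>"
    and comp_con_hom: "(g, f) \<in> Comps S
      \<Longrightarrow> comp_con F (g, f) \<in> Hom2 H (on_arr F g \<odot>\<^bsub>H\<^esub> on_arr F f) (on_arr F (g \<odot>\<^bsub>S\<^esub> f))"
    and comp_con_iso: "(g, f) \<in> Comps S \<Longrightarrow> iso2 H (comp_con F (g, f))"
    and unit_con_hom: "X \<in> Obj S
      \<Longrightarrow> unit_con F X \<in> Hom2 H (Id1 H (on_obj F X)) (on_arr F (Id1 S X))"
    and unit_con_iso: "X \<in> Obj S \<Longrightarrow> iso2 H (unit_con F X)"
    and comp_con_natural: "(g, f) \<in> Comps S \<Longrightarrow> \<sigma> \<in> Hom2 S f f' \<Longrightarrow> \<tau> \<in> Hom2 S g g'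
      \<Longrightarrow> on_cell F (\<tau> \<star>\<^bsub>S\<^esub> \<sigma>) \<cdot>\<^bsub>H\<^esub> comp_con F (g, f)
        = comp_con F (g', f') \<cdot>\<^bsub>H\<^esub> (on_cell F \<tau> \<star>\<^bsub>H\<^esub> on_cell F \<sigma>)"
    and assoc_coherence: "(h, g) \<in> Comps S \<Longrightarrow> (g, f) \<in> Comps S
      \<Longrightarrow> comp_con F (h \<odot>\<^bsub>S\<^esub> g, f) \<cdot>\<^bsub>H\<^esub> (comp_con F (h, g) \<star>\<^bsub>H\<^esub> Id2 H (on_arr F f))
        = comp_con F (h, g \<odot>\<^bsub>S\<^esub> f) \<cdot>\<^bsub>H\<^esub> (Id2 H (on_arr F h) \<star>\<^bsub>H\<^esub> comp_con F (g, f))"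
    and unit_right_coherence: "f \<in> Hom1 S X Y
      \<Longrightarrow> comp_con F (f, Id1 S X) \<cdot>\<^bsub>H\<^esub> (Id2 H (on_arr F f) \<star>\<^bsub>H\<^esub> unit_con F X)
        = Id2 H (on_arr F f)"
    and unit_left_coherence: "f \<in> Hom1 S X Y
      \<Longrightarrow> comp_con F (Id1 S Y, f) \<cdot>\<^bsub>H\<^esub> (unit_con F Y \<star>\<^bsub>H\<^esub> Id2 H (on_arr F f))
        = Id2 H (on_arr F f)"

text \<open>The 2-cell of \<open>\<alpha> : F \<rightarrow> G\<close> at \<open>f : X \<rightarrow> Y\<close> is \<open>\<alpha> f : G f \<odot> \<alpha> X \<Rightarrow> \<alpha> Y \<odot> F f\<close>.\<close>

record ('o, 'a, 'c, 'p, 'b, 'd) psnat =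
  nsrc :: "('o, 'a, 'c, 'p, 'b, 'd) psfun"
  ntgt :: "('o, 'a, 'c, 'p, 'b, 'd) psfun"
  ncomp :: "'o \<Rightarrow> 'b"
  ncell :: "'a \<Rightarrow> 'd"

locale pseudonatural = src: pseudofunctor S H "nsrc \<alpha>" + tgt: pseudofunctor S H "ntgt \<alpha>"
  for S :: "('o, 'a, 'c) twocat" and H :: "('p, 'b, 'd) twocat"
    and \<alpha> :: "('o, 'a, 'c, 'p, 'b, 'd) psnat" +
  assumes ncomp_ext: "ncomp \<alpha> \<in> extensional (Obj S)"
    and ncell_ext: "ncell \<alpha> \<in> extensional (Arr S)"
    and ncomp_hom: "X \<in> Obj S \<Longrightarrow> ncomp \<alpha> X \<in> Hom1 H (on_obj (nsrc \<alpha>) X) (on_obj (ntgt \<alpha>) X)"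
    and ncell_hom: "f \<in> Hom1 S X Y
      \<Longrightarrow> ncell \<alpha> f \<in> Hom2 H (on_arr (ntgt \<alpha>) f \<odot>\<^bsub>H\<^esub> ncomp \<alpha> X) (ncomp \<alpha> Y \<odot>\<^bsub>H\<^esub> on_arr (nsrc \<alpha>) f)"
    and ncell_iso: "f \<in> Arr S \<Longrightarrow> iso2 H (ncell \<alpha> f)"
    and ncell_natural: "f \<in> Hom1 S X Y \<Longrightarrow> \<sigma> \<in> Hom2 S f f'
      \<Longrightarrow> ncell \<alpha> f' \<cdot>\<^bsub>H\<^esub> (on_cell (ntgt \<alpha>) \<sigma> \<star>\<^bsub>H\<^esub> Id2 H (ncomp \<alpha> X))
        = (Id2 H (ncomp \<alpha> Y) \<star>\<^bsub>H\<^esub> on_cell (nsrc \<alpha>) \<sigma>) \<cdot>\<^bsub>H\<^esub> ncell \<alpha> f"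
    and ncell_comp: "f \<in> Hom1 S X Y \<Longrightarrow> g \<in> Hom1 S Y Z
      \<Longrightarrow> ncell \<alpha> (g \<odot>\<^bsub>S\<^esub> f) \<cdot>\<^bsub>H\<^esub> (comp_con (ntgt \<alpha>) (g, f) \<star>\<^bsub>H\<^esub> Id2 H (ncomp \<alpha> X))
        = (Id2 H (ncomp \<alpha> Z) \<star>\<^bsub>H\<^esub> comp_con (nsrc \<alpha>) (g, f))
          \<cdot>\<^bsub>H\<^esub> (ncell \<alpha> g \<star>\<^bsub>H\<^esub> Id2 H (on_arr (nsrc \<alpha>) f))
          \<cdot>\<^bsub>H\<^esub> (Id2 H (on_arr (ntgt \<alpha>) g) \<star>\<^bsub>H\<^esub> ncell \<alpha> f)"
    and ncell_unit: "X \<in> Obj S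
      \<Longrightarrow> ncell \<alpha> (Id1 S X) \<cdot>\<^bsub>H\<^esub> (unit_con (ntgt \<alpha>) X \<star>\<^bsub>H\<^esub> Id2 H (ncomp \<alpha> X))
        = Id2 H (ncomp \<alpha> X) \<star>\<^bsub>H\<^esub> unit_con (nsrc \<alpha>) X"

record ('o, 'a, 'c, 'p, 'b, 'd) psmod =
  msrc :: "('o, 'a, 'c, 'p, 'b, 'd) psnat"
  mtgt :: "('o, 'a, 'c, 'p, 'b, 'd) psnat"
  mcomp :: "'o \<Rightarrow> 'd"

locale modification = src: pseudonatural S H "msrc \<Gamma>" + tgt: pseudonatural S H "mtgt \<Gamma>"
  for S :: "('o, 'a, 'c) twocat" and H :: "('p, 'b, 'd) twocat"
    and \<Gamma> :: "('o, 'a, 'c, 'p, 'b, 'd) psmod" +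
  assumes same_src: "nsrc (mtgt \<Gamma>) = nsrc (msrc \<Gamma>)"
    and same_tgt: "ntgt (mtgt \<Gamma>) = ntgt (msrc \<Gamma>)"
    and mcomp_ext: "mcomp \<Gamma> \<in> extensional (Obj S)"
    and mcomp_hom: "X \<in> Obj S \<Longrightarrow> mcomp \<Gamma> X \<in> Hom2 H (ncomp (msrc \<Gamma>) X) (ncomp (mtgt \<Gamma>) X)"
    and mcomp_natural: "f \<in> Hom1 S X Y
      \<Longrightarrow> ncell (mtgt \<Gamma>) f \<cdot>\<^bsub>H\<^esub> (Id2 H (on_arr (ntgt (msrc \<Gamma>)) f) \<star>\<^bsub>H\<^esub> mcomp \<Gamma> X)
        = (mcomp \<Gamma> Y \<star>\<^bsub>H\<^esub> Id2 H (on_arr (nsrc (msrc \<Gamma>)) f)) \<cdot>\<^bsub>H\<^esub> ncell (msrc \<Gamma>) f"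

definition psnat_comp :: "('o, 'a, 'c) twocat \<Rightarrow> ('p, 'b, 'd) twocat
    \<Rightarrow> ('o, 'a, 'c, 'p, 'b, 'd) psnat \<Rightarrow> ('o, 'a, 'c, 'p, 'b, 'd) psnat
    \<Rightarrow> ('o, 'a, 'c, 'p, 'b, 'd) psnat" where
  "psnat_comp S H \<beta> \<alpha> =
     \<lparr>nsrc = nsrc \<alpha>, ntgt = ntgt \<beta>,
      ncomp = (\<lambda>X\<in>Obj S. ncomp \<beta> X \<odot>\<^bsub>H\<^esub> ncomp \<alpha> X),
      ncell = (\<lambda>f\<in>Arr S. (Id2 H (ncomp \<beta> (Cod S f)) \<star>\<^bsub>H\<^esub> ncell \<alpha> f)
                 \<cdot>\<^bsub>H\<^esub> (ncell \<beta> f \<star>\<^bsub>H\<^esub> Id2 H (ncomp \<alpha> (Dom S f))))\<rparr>"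

text \<open>The 2-category \<open>[S, H]\<^sub>P\<^sub>S\<close>.\<close>

definition PS :: "('o, 'a, 'c) twocat \<Rightarrow> ('p, 'b, 'd) twocat
    \<Rightarrow> (('o, 'a, 'c, 'p, 'b, 'd) psfun, ('o, 'a, 'c, 'p, 'b, 'd) psnat,
        ('o, 'a, 'c, 'p, 'b, 'd) psmod) twocat" where
  "PS S H =
     \<lparr>Obj = {F. pseudofunctor S H F}, Arr = {\<alpha>. pseudonatural S H \<alpha>}, Cell = {\<Gamma>. modification S H \<Gamma>},
      Dom = nsrc, Cod = ntgt, Src = msrc, Tgt = mtgt,
      Id1 = (\<lambda>F. \<lparr>nsrc = F, ntgt = F, ncomp = (\<lambda>X\<in>Obj S. Id1 H (on_obj F X)),
        ncell = (\<lambda>f\<in>Arr S. Id2 H (on_arr F f))\<rparr>),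
      Id2 = (\<lambda>\<alpha>. \<lparr>msrc = \<alpha>, mtgt = \<alpha>, mcomp = (\<lambda>X\<in>Obj S. Id2 H (ncomp \<alpha> X))\<rparr>),
      Comp1 = psnat_comp S H,
      VComp = (\<lambda>\<Delta> \<Gamma>. \<lparr>msrc = msrc \<Gamma>, mtgt = mtgt \<Delta>,
        mcomp = (\<lambda>X\<in>Obj S. mcomp \<Delta> X \<cdot>\<^bsub>H\<^esub> mcomp \<Gamma> X)\<rparr>),
      HComp = (\<lambda>\<Delta> \<Gamma>. \<lparr>msrc = psnat_comp S H (msrc \<Delta>) (msrc \<Gamma>),
        mtgt = psnat_comp S H (mtgt \<Delta>) (mtgt \<Gamma>),
        mcomp = (\<lambda>X\<in>Obj S. mcomp \<Delta> X \<star>\<^bsub>H\<^esub> mcomp \<Gamma> X)\<rparr>)\<rparr>"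


section \<open>Composition and whiskering\<close>

text \<open>A 2-functor (strict), given by its action on cells, with identity constraints.\<close>

definition strict_psf :: "('o, 'a, 'c) twocat \<Rightarrow> ('p, 'b, 'd) twocat
    \<Rightarrow> ('o \<Rightarrow> 'p) \<Rightarrow> ('a \<Rightarrow> 'b) \<Rightarrow> ('c \<Rightarrow> 'd) \<Rightarrow> ('o, 'a, 'c, 'p, 'b, 'd) psfun" where
  "strict_psf S H F0 F1 F2 =
     \<lparr>on_obj = restrict F0 (Obj S), on_arr = restrict F1 (Arr S), on_cell = restrict F2 (Cell S),
      comp_con = (\<lambda>(g, f)\<in>Comps S. Id2 H (F1 (g \<odot>\<^bsub>S\<^esub> f))),
      unit_con = (\<lambda>X\<in>Obj S. Id2 H (Id1 H (F0 X)))\<rparr>"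

definition psf_id :: "('o, 'a, 'c) twocat \<Rightarrow> ('o, 'a, 'c, 'o, 'a, 'c) psfun" where
  "psf_id S = strict_psf S S (\<lambda>X. X) (\<lambda>f. f) (\<lambda>\<sigma>. \<sigma>)"

text \<open>\<open>psf_comp S U G F\<close> is \<open>G \<circ> F\<close>, where \<open>S\<close> is the domain of \<open>F\<close> and \<open>U\<close> the codomain of \<open>G\<close>.\<close>

definition psf_comp :: "('o, 'a, 'c) twocat \<Rightarrow> ('q, 'e, 'g) twocat
    \<Rightarrow> ('p, 'b, 'd, 'q, 'e, 'g) psfun \<Rightarrow> ('o, 'a, 'c, 'p, 'b, 'd) psfun
    \<Rightarrow> ('o, 'a, 'c, 'q, 'e, 'g) psfun" where
  "psf_comp S U G F =
     \<lparr>on_obj = (\<lambda>X\<in>Obj S. on_obj G (on_obj F X)),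
      on_arr = (\<lambda>f\<in>Arr S. on_arr G (on_arr F f)),
      on_cell = (\<lambda>\<sigma>\<in>Cell S. on_cell G (on_cell F \<sigma>)),
      comp_con = (\<lambda>(g, f)\<in>Comps S.
        on_cell G (comp_con F (g, f)) \<cdot>\<^bsub>U\<^esub> comp_con G (on_arr F g, on_arr F f)),
      unit_con = (\<lambda>X\<in>Obj S. on_cell G (unit_con F X) \<cdot>\<^bsub>U\<^esub> unit_con G (on_obj F X))\<rparr>"

text \<open>\<open>whisker_right S U \<alpha> P\<close> is \<open>\<alpha> P\<close>, with \<open>P\<close> defined on \<open>S\<close> and \<open>\<alpha>\<close> taking values in \<open>U\<close>.\<close>

definition whisker_right :: "('o, 'a, 'c) twocat \<Rightarrow> ('q, 'e, 'g) twocat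
    \<Rightarrow> ('p, 'b, 'd, 'q, 'e, 'g) psnat \<Rightarrow> ('o, 'a, 'c, 'p, 'b, 'd) psfun
    \<Rightarrow> ('o, 'a, 'c, 'q, 'e, 'g) psnat" where
  "whisker_right S U \<alpha> P =
     \<lparr>nsrc = psf_comp S U (nsrc \<alpha>) P, ntgt = psf_comp S U (ntgt \<alpha>) P,
      ncomp = (\<lambda>X\<in>Obj S. ncomp \<alpha> (on_obj P X)),
      ncell = (\<lambda>f\<in>Arr S. ncell \<alpha> (on_arr P f))\<rparr>"

text \<open>\<open>whisker_left S U G \<alpha>\<close> is \<open>G \<alpha>\<close>, with \<open>\<alpha>\<close> defined on \<open>S\<close> and \<open>G\<close> taking values in \<open>U\<close>.\<close>

definition whisker_left :: "('o, 'a, 'c) twocat \<Rightarrow> ('q, 'e, 'g) twocat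
    \<Rightarrow> ('p, 'b, 'd, 'q, 'e, 'g) psfun \<Rightarrow> ('o, 'a, 'c, 'p, 'b, 'd) psnat
    \<Rightarrow> ('o, 'a, 'c, 'q, 'e, 'g) psnat" where
  "whisker_left S U G \<alpha> =
     \<lparr>nsrc = psf_comp S U G (nsrc \<alpha>), ntgt = psf_comp S U G (ntgt \<alpha>),
      ncomp = (\<lambda>X\<in>Obj S. on_arr G (ncomp \<alpha> X)),
      ncell = (\<lambda>f\<in>Arr S.
        inv2 U (comp_con G (ncomp \<alpha> (Cod S f), on_arr (nsrc \<alpha>) f))
        \<cdot>\<^bsub>U\<^esub> on_cell G (ncell \<alpha> f)
        \<cdot>\<^bsub>U\<^esub> comp_con G (on_arr (ntgt \<alpha>) f, ncomp \<alpha> (Dom S f)))\<rparr>"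

text \<open>The 2-functor \<open>- \<circ> P : [T, H]\<^sub>P\<^sub>S \<rightarrow> [S, H]\<^sub>P\<^sub>S\<close> for \<open>P : S \<rightarrow> T\<close>.\<close>

definition precomp :: "('o, 'a, 'c) twocat \<Rightarrow> ('p, 'b, 'd) twocat \<Rightarrow> ('q, 'e, 'g) twocat
    \<Rightarrow> ('o, 'a, 'c, 'p, 'b, 'd) psfun
    \<Rightarrow> (('p, 'b, 'd, 'q, 'e, 'g) psfun, ('p, 'b, 'd, 'q, 'e, 'g) psnat, ('p, 'b, 'd, 'q, 'e, 'g) psmod,
        ('o, 'a, 'c, 'q, 'e, 'g) psfun, ('o, 'a, 'c, 'q, 'e, 'g) psnat, ('o, 'a, 'c, 'q, 'e, 'g) psmod)
        psfun" where
  "precomp S T H P = strict_psf (PS T H) (PS S H)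
     (\<lambda>F. psf_comp S H F P)
     (\<lambda>\<alpha>. whisker_right S H \<alpha> P)
     (\<lambda>\<Gamma>. \<lparr>msrc = whisker_right S H (msrc \<Gamma>) P, mtgt = whisker_right S H (mtgt \<Gamma>) P,
           mcomp = (\<lambda>X\<in>Obj S. mcomp \<Gamma> (on_obj P X))\<rparr>)"


section \<open>Representable 2-functors\<close>

text \<open>
  The hom-category \<open>K(X, Y)\<close>, with objects and arrows relabelled by injections \<open>i\<close> and \<open>k\<close>. The
  relabelling serves to place categories of different types in a single instance of \<open>CAT\<close>.
\<close>

definition hom_cat :: "('a \<Rightarrow> 'x) \<Rightarrow> ('c \<Rightarrow> 'y) \<Rightarrow> ('o, 'a, 'c) twocat \<Rightarrow> 'o \<Rightarrow> 'o \<Rightarrow> ('x, 'y) cat" where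
  "hom_cat i k K X Y =
     \<lparr>cobj = i ` Hom1 K X Y, carr = k ` {\<sigma> \<in> Cell K. Src K \<sigma> \<in> Hom1 K X Y},
      cdom = (\<lambda>s. i (Src K (inv k s))), ccod = (\<lambda>s. i (Tgt K (inv k s))),
      cid = (\<lambda>h. k (Id2 K (inv i h))),
      ccomp = (\<lambda>t s. k (inv k t \<cdot>\<^bsub>K\<^esub> inv k s))\<rparr>"

definition post_functor :: "('a \<Rightarrow> 'x) \<Rightarrow> ('c \<Rightarrow> 'y) \<Rightarrow> ('o, 'a, 'c) twocat \<Rightarrow> 'o \<Rightarrow> 'a
    \<Rightarrow> ('x, 'y) cfunctor" where
  "post_functor i k K X g =
     \<lparr>fsrc = hom_cat i k K X (Dom K g), ftgt = hom_cat i k K X (Cod K g),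
      fobj = (\<lambda>h\<in>cobj (hom_cat i k K X (Dom K g)). i (g \<odot>\<^bsub>K\<^esub> inv i h)),
      farr = (\<lambda>s\<in>carr (hom_cat i k K X (Dom K g)). k (Id2 K g \<star>\<^bsub>K\<^esub> inv k s))\<rparr>"

text \<open>\<open>rep i k K X\<close> is the covariant 2-functor \<open>K(X, -) : K \<rightarrow> CAT\<close>.\<close>

definition rep :: "('a \<Rightarrow> 'x) \<Rightarrow> ('c \<Rightarrow> 'y) \<Rightarrow> ('o, 'a, 'c) twocat \<Rightarrow> 'o
    \<Rightarrow> ('o, 'a, 'c, ('x, 'y) cat, ('x, 'y) cfunctor, ('x, 'y) ctrans) psfun" where
  "rep i k K X = strict_psf K CAT
     (\<lambda>Y. hom_cat i k K X Y)
     (\<lambda>g. post_functor i k K X g)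
     (\<lambda>\<tau>. \<lparr>tsrc = post_functor i k K X (Src K \<tau>), ttgt = post_functor i k K X (Tgt K \<tau>),
           tcomp = (\<lambda>h\<in>cobj (hom_cat i k K X (Dom K (Src K \<tau>))). k (\<tau> \<star>\<^bsub>K\<^esub> Id2 K (inv i h)))\<rparr>)"

definition pre_functor :: "('a \<Rightarrow> 'x) \<Rightarrow> ('c \<Rightarrow> 'y) \<Rightarrow> ('o, 'a, 'c) twocat \<Rightarrow> 'a \<Rightarrow> 'o
    \<Rightarrow> ('x, 'y) cfunctor" where
  "pre_functor i k K f Y =
     \<lparr>fsrc = hom_cat i k K (Cod K f) Y, ftgt = hom_cat i k K (Dom K f) Y,
      fobj = (\<lambda>h\<in>cobj (hom_cat i k K (Cod K f) Y). i (inv i h \<odot>\<^bsub>K\<^esub> f)),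
      farr = (\<lambda>s\<in>carr (hom_cat i k K (Cod K f) Y). k (inv k s \<star>\<^bsub>K\<^esub> Id2 K f))\<rparr>"

definition pre_nat :: "('a \<Rightarrow> 'x) \<Rightarrow> ('c \<Rightarrow> 'y) \<Rightarrow> ('o, 'a, 'c) twocat \<Rightarrow> 'a
    \<Rightarrow> ('o, 'a, 'c, ('x, 'y) cat, ('x, 'y) cfunctor, ('x, 'y) ctrans) psnat" where
  "pre_nat i k K f =
     \<lparr>nsrc = rep i k K (Cod K f), ntgt = rep i k K (Dom K f),
      ncomp = (\<lambda>Y\<in>Obj K. pre_functor i k K f Y),
      ncell = (\<lambda>g\<in>Arr K.
        Id2 CAT (functor_comp (post_functor i k K (Dom K f) g) (pre_functor i k K f (Dom K g))))\<rparr>"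

text \<open>The Yoneda 2-functor \<open>X \<mapsto> K(X, -)\<close> from \<open>K\<^sup>o\<^sup>p\<close> to \<open>[K, CAT]\<^sub>P\<^sub>S\<close>.\<close>

definition yoneda :: "('a \<Rightarrow> 'x) \<Rightarrow> ('c \<Rightarrow> 'y) \<Rightarrow> ('o, 'a, 'c) twocat
    \<Rightarrow> ('o, 'a, 'c,
        ('o, 'a, 'c, ('x, 'y) cat, ('x, 'y) cfunctor, ('x, 'y) ctrans) psfun,
        ('o, 'a, 'c, ('x, 'y) cat, ('x, 'y) cfunctor, ('x, 'y) ctrans) psnat,
        ('o, 'a, 'c, ('x, 'y) cat, ('x, 'y) cfunctor, ('x, 'y) ctrans) psmod) psfun" where
  "yoneda i k K = strict_psf (op1 K) (PS K CAT)
     (\<lambda>X. rep i k K X)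
     (\<lambda>f. pre_nat i k K f)
     (\<lambda>\<phi>. \<lparr>msrc = pre_nat i k K (Src K \<phi>), mtgt = pre_nat i k K (Tgt K \<phi>),
           mcomp = (\<lambda>Y\<in>Obj K.
             \<lparr>tsrc = pre_functor i k K (Src K \<phi>) Y, ttgt = pre_functor i k K (Tgt K \<phi>) Y,
              tcomp = (\<lambda>h\<in>cobj (hom_cat i k K (Cod K (Src K \<phi>)) Y).
                k (Id2 K (inv i h) \<star>\<^bsub>K\<^esub> \<phi>))\<rparr>)\<rparr>)"


section \<open>Weighted bilimits and bicategorical completeness\<close>

text \<open>
  For \<open>W : S \<rightarrow> CAT\<close> and \<open>D : S \<rightarrow> H\<close>: the 2-functor \<open>X \<mapsto> [S, CAT]\<^sub>P\<^sub>S(W, H(X, D -))\<close> from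
  \<open>H\<^sup>o\<^sup>p\<close> to \<open>CAT\<close>. The weight takes values in categories with objects in \<open>'w + 'a\<close> and arrows in
  \<open>'w + 'c\<close>, so that one instance of \<open>CAT\<close> contains the hom-categories of \<open>H\<close> (tagged by
  \<open>Inr\<close>) and categories that live on \<open>'w\<close>.
\<close>

definition weighted_cones where
  "weighted_cones S H
     (W :: ('s, 't, 'v, ('w + 'a, 'w + 'c) cat, ('w + 'a, 'w + 'c) cfunctor,
            ('w + 'a, 'w + 'c) ctrans) psfun)
     (D :: ('s, 't, 'v, 'o, 'a, 'c) psfun) =
   psf_comp (op1 H) CAT (rep Inr Inr (PS S CAT) W)
     (psf_comp (op1 H) (PS S CAT) (precomp S H CAT D) (yoneda Inr Inr H))"

text \<open>
  \<open>L\<close> is a bilimit of \<open>D\<close> weighted by \<open>W\<close>: there is an equivalence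
  \<open>H(X, L) \<simeq> [S, CAT]\<^sub>P\<^sub>S(W, H(X, D -))\<close>, pseudonatural in \<open>X\<close>. The functor \<open>H(-, L)\<close> is the
  covariant representable of \<open>H\<^sup>o\<^sup>p\<close> at \<open>L\<close>.
\<close>

definition is_bilimit where
  "is_bilimit S H W D L \<longleftrightarrow> L \<in> Obj H \<and>
     (\<exists>\<Phi>\<in>Hom1 (PS (op1 H) CAT) (rep Inl Inl (op1 H) L) (weighted_cones S H W D).
        \<forall>X\<in>Obj H. equivalence1 CAT (ncomp \<Phi> X))"

text \<open>
  Smallness is relative to a type \<open>'u\<close> which plays the role of a universe: a set is small if its
  cardinality is strictly less than that of \<open>'u\<close>. Up to isomorphism, every small 2-category has its
  cells in \<open>'u\<close>, and every small category occurs among the values of weights.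
\<close>

definition small_twocat :: "('u, 'u, 'u) twocat \<Rightarrow> bool" where
  "small_twocat S \<longleftrightarrow> two_category S \<and>
     Obj S \<prec> (UNIV :: 'u set) \<and> Arr S \<prec> (UNIV :: 'u set) \<and> Cell S \<prec> (UNIV :: 'u set)"

definition bicategorically_complete :: "'u itself \<Rightarrow> ('o, 'a, 'c) twocat \<Rightarrow> bool" where
  "bicategorically_complete (_ :: 'u itself) H \<longleftrightarrow>
     (\<forall>(S :: ('u, 'u, 'u) twocat)
       (W :: ('u, 'u, 'u, ('u + 'a, 'u + 'c) cat, ('u + 'a, 'u + 'c) cfunctor,
              ('u + 'a, 'u + 'c) ctrans) psfun) D.
        small_twocat S \<and> pseudofunctor S CAT W \<and> pseudofunctor S H D \<and>
        (\<forall>s\<in>Obj S. cobj (on_obj W s) \<prec> (UNIV :: 'u set) \<and> carr (on_obj W s) \<prec> (UNIV :: 'u set))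
        \<longrightarrow> (\<exists>L. is_bilimit S H W D L))"


section \<open>Biadjunctions\<close>

text \<open>
  \<open>L : K \<rightarrow> M\<close> is left biadjoint to \<open>R : M \<rightarrow> K\<close>, with unit \<open>\<eta> : Id \<rightarrow> R L\<close>, counit
  \<open>\<epsilon> : L R \<rightarrow> Id\<close> and invertible modifications \<open>s : Id\<^sub>L \<Rightarrow> (\<epsilon> L) \<odot> (L \<eta>)\<close> and
  \<open>t : (R \<epsilon>) \<odot> (\<eta> R) \<Rightarrow> Id\<^sub>R\<close> filling the triangles. The last two conditions are the two swallowtail
  identities; the first says that the composite
  \<open>\<epsilon> y \<Rightarrow> \<epsilon> y \<odot> \<epsilon> (L R y) \<odot> L (\<eta> (R y)) \<Rightarrow> \<epsilon> y \<odot> L R (\<epsilon> y) \<odot> L (\<eta> (R y)) \<Rightarrow> \<epsilon> y \<odot> L (Id (R y)) \<Rightarrow> \<epsilon> y\<close>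
  is an identity, and the second one is its dual.
\<close>

definition biadjunction where
  "biadjunction K M L R \<eta> \<epsilon> s t \<longleftrightarrow>
     two_category K \<and> two_category M \<and> pseudofunctor K M L \<and> pseudofunctor M K R \<and>
     \<eta> \<in> Hom1 (PS K K) (psf_id K) (psf_comp K K R L) \<and>
     \<epsilon> \<in> Hom1 (PS M M) (psf_comp M M L R) (psf_id M) \<and>
     s \<in> Hom2 (PS K M) (Id1 (PS K M) L) (whisker_right K M \<epsilon> L \<odot>\<^bsub>PS K M\<^esub> whisker_left K M L \<eta>) \<and>
     t \<in> Hom2 (PS M K) (whisker_left M K R \<epsilon> \<odot>\<^bsub>PS M K\<^esub> whisker_right M K \<eta> R) (Id1 (PS M K) R) \<and>
     iso2 (PS K M) s \<and> iso2 (PS M K) t \<and>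
     (\<forall>y\<in>Obj M.
        (Id2 M (ncomp \<epsilon> y) \<star>\<^bsub>M\<^esub>
           (inv2 M (unit_con L (on_obj R y)) \<cdot>\<^bsub>M\<^esub> on_cell L (mcomp t y)
            \<cdot>\<^bsub>M\<^esub> comp_con L (on_arr R (ncomp \<epsilon> y), ncomp \<eta> (on_obj R y))))
        \<cdot>\<^bsub>M\<^esub> (ncell \<epsilon> (ncomp \<epsilon> y) \<star>\<^bsub>M\<^esub> Id2 M (on_arr L (ncomp \<eta> (on_obj R y))))
        \<cdot>\<^bsub>M\<^esub> (Id2 M (ncomp \<epsilon> y) \<star>\<^bsub>M\<^esub> mcomp s (on_obj R y))
        = Id2 M (ncomp \<epsilon> y)) \<and>
     (\<forall>x\<in>Obj K.
        (mcomp t (on_obj L x) \<star>\<^bsub>K\<^esub> Id2 K (ncomp \<eta> x))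
        \<cdot>\<^bsub>K\<^esub> (Id2 K (on_arr R (ncomp \<epsilon> (on_obj L x))) \<star>\<^bsub>K\<^esub> ncell \<eta> (ncomp \<eta> x))
        \<cdot>\<^bsub>K\<^esub> ((inv2 K (comp_con R (ncomp \<epsilon> (on_obj L x), on_arr L (ncomp \<eta> x)))
                \<cdot>\<^bsub>K\<^esub> on_cell R (mcomp s x) \<cdot>\<^bsub>K\<^esub> unit_con R (on_obj L x))
              \<star>\<^bsub>K\<^esub> Id2 K (ncomp \<eta> x))
        = Id2 K (ncomp \<eta> x))"


section \<open>Faithful 1-cells\<close>

definition faithful1 :: "('o, 'a, 'c) twocat \<Rightarrow> 'a \<Rightarrow> bool" where
  "faithful1 H f \<longleftrightarrow> f \<in> Arr H \<and> (\<forall>X\<in>Obj H. faithful_functor (on_arr (rep id id H X) f))"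

definition fully_faithful1 :: "('o, 'a, 'c) twocat \<Rightarrow> 'a \<Rightarrow> bool" where
  "fully_faithful1 H f \<longleftrightarrow> f \<in> Arr H \<and>
     (\<forall>X\<in>Obj H. faithful_functor (on_arr (rep id id H X) f) \<and> full_functor (on_arr (rep id id H X) f))"

definition objectwise_faithful where
  "objectwise_faithful S H \<alpha> \<longleftrightarrow> (\<forall>X\<in>Obj S. faithful1 H (ncomp \<alpha> X))"

definition objectwise_fully_faithful where
  "objectwise_fully_faithful S H \<alpha> \<longleftrightarrow> (\<forall>X\<in>Obj S. fully_faithful1 H (ncomp \<alpha> X))"


section \<open>Finite ordinals and descent\<close>

text \<open>
  The ordinal \<open>n\<close> is the set of natural numbers less than \<open>n\<close>; a morphism \<open>m \<rightarrow> n\<close> is a triple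
  \<open>(m, n, f)\<close>.
\<close>

type_synonym ordmap = "nat \<times> nat \<times> (nat \<Rightarrow> nat)"

definition fin_ord_cat :: "nat set \<Rightarrow> (nat, ordmap) cat" where
  "fin_ord_cat N =
     \<lparr>cobj = N,
      carr = {(m, n, f). m \<in> N \<and> n \<in> N \<and> f \<in> {..<m} \<rightarrow>\<^sub>E {..<n} \<and> mono_on {..<m} f},
      cdom = (\<lambda>(m, n, f). m), ccod = (\<lambda>(m, n, f). n),
      cid = (\<lambda>n. (n, n, \<lambda>i\<in>{..<n}. i)),
      ccomp = (\<lambda>(n', p, g) (m, n, f). (m, p, compose {..<m} g f))\<rparr>"

definition Delta_dot :: "(nat, ordmap, ordmap) twocat" where
  "Delta_dot = locally_discrete (fin_ord_cat UNIV)"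

definition Delta :: "(nat, ordmap, ordmap) twocat" where
  "Delta = locally_discrete (fin_ord_cat {1..})"

definition j_incl :: "(nat, ordmap, ordmap, nat, ordmap, ordmap) psfun" where
  "j_incl = strict_psf Delta Delta_dot (\<lambda>n. n) (\<lambda>f. f) (\<lambda>f. f)"

text \<open>\<open>R\<close> is \<open>PsRan\<^sub>j\<close>, a right biadjoint of \<open>- \<circ> j\<close>, with unit \<open>\<eta>\<close> and the remaining data of a biadjunction.\<close>

definition is_PsRan_j where
  "is_PsRan_j H R \<eta> \<epsilon> s t \<longleftrightarrow>
     biadjunction (PS Delta_dot H) (PS Delta H) (precomp Delta Delta_dot H j_incl) R \<eta> \<epsilon> s t"

text \<open>
  The component \<open>\<eta>\<^sub>A : A \<rightarrow> PsRan\<^sub>j (A \<circ> j)\<close> of the unit is itself a pseudonatural transformation; the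
  conditions are about its component at the empty ordinal.
\<close>

definition almost_j_descent where
  "almost_j_descent H \<eta> A \<longleftrightarrow> faithful1 H (ncomp (ncomp \<eta> A) (0 :: nat))"

definition j_descent where
  "j_descent H \<eta> A \<longleftrightarrow> fully_faithful1 H (ncomp (ncomp \<eta> A) (0 :: nat))"

end

theory Submission
  imports Defs
begin

text \<open>
  Pseudonaturality of \<open>\<eta>\<close> at \<open>\<alpha>\<close> gives an invertible 2-cell from \<open>(R L \<alpha>)\<^sub>0 \<odot> (\<eta> A)\<^sub>0\<close> to
  \<open>(\<eta> B)\<^sub>0 \<odot> \<alpha>\<^sub>0\<close>, where \<open>L\<close> is restriction along \<open>j\<close> and \<open>R\<close> is \<open>PsRan\<^sub>j\<close>. If \<open>(\<eta> B)\<^sub>0\<close> and \<open>\<alpha>\<^sub>0\<close> are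
  faithful, so is their composite, hence so is the right factor \<open>(\<eta> A)\<^sub>0\<close>. In the fully faithful
  case the same cancellation needs \<open>(R L \<alpha>)\<^sub>0\<close> to be faithful. This holds because \<open>L \<alpha>\<close> is objectwise
  faithful, hence a faithful 1-cell, because right biadjoints preserve faithful 1-cells, and because
  evaluation at the initial object 0 does so too: it is represented by constant pseudofunctors.
\<close>

section \<open>Whiskering in a 2-category\<close>

text \<open>The two halves differ because full faithfulness does not pass to a right factor
  unconditionally: in \<open>CAT\<close>, a point mapped into a nontrivial group (a one-object
  category) and then to the terminal category gives an identity, yet the first functor is not full.
  A lift through a composite \<open>g \<odot> f\<close> is controlled only after whiskering with
  \<open>g\<close>, so \<open>g\<close> has to be faithful.

  What is known about \<open>R\<close> comes from the biadjunction data. Faithfulness is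
  cancellation of 2-cells under left whiskering, so it is enough that transposing along a
  biadjunction, or extending from the initial object, is injective on 2-cells; no equivalence of
  hom-categories is built. Every comparison is made along an invertible 2-cell: a pseudonaturality
  square, a triangle, or a constraint of a pseudofunctor.\<close>

lemma iso2E:
  assumes "iso2 K \<omega>" "\<omega> \<in> Hom2 K f g"
  obtains \<omega>' where "\<omega>' \<in> Hom2 K g f" "\<omega>' \<cdot>\<^bsub>K\<^esub> \<omega> = Id2 K f" "\<omega> \<cdot>\<^bsub>K\<^esub> \<omega>' = Id2 K g"
    "iso2 K \<omega>'"
  using assms unfolding iso2_def inverse2_def Hom2_def by fastforce

context two_category
begin

lemma hom1_id2: "f \<in> Hom1 K X Y \<Longrightarrow> Id2 K f \<in> Hom2 K f f"
  using id2_hom by (simp add: Hom1_def)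

lemma hom2_tgt: "\<sigma> \<in> Hom2 K f g \<Longrightarrow> f \<in> Hom1 K X Y \<Longrightarrow> g \<in> Hom1 K X Y"
  using src_tgt[of \<sigma>] by (auto simp: Hom1_def Hom2_def)

lemma whisker_hom:
  assumes "f \<in> Hom1 K X Y" "g \<in> Hom1 K Y Z" "\<sigma> \<in> Hom2 K f f'"
  shows "Id2 K g \<star> \<sigma> \<in> Hom2 K (g \<odot> f) (g \<odot> f')"
  using hcomp_hom[OF assms(1,2,3)] hom1_id2[OF assms(2)] by blast

lemma whisker_comp:
  assumes h: "h \<in> Hom1 K X Y" "\<sigma> \<in> Hom2 K h h'" and f: "f \<in> Hom1 K Y Z" and g: "g \<in> Hom1 K Z V"
  shows "Id2 K (g \<odot> f) \<star> \<sigma> = Id2 K g \<star> Id2 K f \<star> \<sigma>"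
  using hcomp_id2[OF f g] hcomp_assoc[OF h(1) f g h(2) hom1_id2[OF f] hom1_id2[OF g]] by simp

lemma whisker_vcomp:
  assumes h: "h \<in> Hom1 K X Y" and \<sigma>: "\<sigma> \<in> Hom2 K h h'" "\<tau> \<in> Hom2 K h' h''" and f: "f \<in> Hom1 K Y Z"
  shows "Id2 K f \<star> (\<tau> \<cdot> \<sigma>) = (Id2 K f \<star> \<tau>) \<cdot> (Id2 K f \<star> \<sigma>)"
  using interchange[OF h f \<sigma> hom1_id2[OF f] hom1_id2[OF f]] vcomp_id_left[OF hom1_id2[OF f]] by simp

lemma vcomp_whisker:
  assumes h: "h \<in> Hom1 K X Y" and f: "f \<in> Hom1 K Y Z" and \<sigma>: "\<sigma> \<in> Hom2 K f f'" "\<tau> \<in> Hom2 K f' f''"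
  shows "(\<tau> \<cdot> \<sigma>) \<star> Id2 K h = (\<tau> \<star> Id2 K h) \<cdot> (\<sigma> \<star> Id2 K h)"
  using interchange[OF h f hom1_id2[OF h] hom1_id2[OF h] \<sigma>] vcomp_id_left[OF hom1_id2[OF h]] by simp

text \<open>Both sides are the horizontal composite of \<open>\<omega>\<close> and
  \<open>\<sigma>\<close>, by interchange with identities.\<close>

lemma whisker_exchange:
  assumes "h \<in> Hom1 K X Y" "\<sigma> \<in> Hom2 K h h'" "f \<in> Hom1 K Y Z" "\<omega> \<in> Hom2 K f f'"
  shows "(\<omega> \<star> Id2 K h') \<cdot> (Id2 K f \<star> \<sigma>) = (Id2 K f' \<star> \<sigma>) \<cdot> (\<omega> \<star> Id2 K h)"
proof -
  have h': "h' \<in> Hom1 K X Y" and f': "f' \<in> Hom1 K Y Z"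
    using assms hom2_tgt by blast+
  show ?thesis
    using interchange[OF assms(1,3,2) hom1_id2[OF h'] hom1_id2[OF assms(3)] assms(4)]
      interchange[OF assms(1,3) hom1_id2[OF assms(1)] assms(2,4) hom1_id2[OF f']]
    by (simp add: vcomp_id_left[OF assms(2)] vcomp_id_left[OF assms(4)]
        vcomp_id_right[OF assms(2)] vcomp_id_right[OF assms(4)])
qed

section \<open>Cancelling and whiskering invertible 2-cells\<close>

lemma iso2_cancel_left:
  assumes "iso2 K \<omega>" "\<omega> \<in> Hom2 K g k" "\<sigma> \<in> Hom2 K f g" "\<sigma>' \<in> Hom2 K f g" "\<omega> \<cdot> \<sigma> = \<omega> \<cdot> \<sigma>'"
  shows "\<sigma> = \<sigma>'"
proof -
  obtain \<omega>' where \<omega>': "\<omega>' \<in> Hom2 K k g" "\<omega>' \<cdot> \<omega> = Id2 K g"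
    using assms(1,2) by (rule iso2E)
  have "\<sigma> = \<omega>' \<cdot> \<omega> \<cdot> \<sigma>"
    using vcomp_assoc[OF assms(3,2) \<omega>'(1)] \<omega>'(2) vcomp_id_left[OF assms(3)] by simp
  also have "\<dots> = \<sigma>'"
    using vcomp_assoc[OF assms(4,2) \<omega>'(1)] \<omega>'(2) vcomp_id_left[OF assms(4)] assms(5) by simp
  finally show ?thesis .
qed

lemma iso2_cancel_right:
  assumes "iso2 K \<omega>" "\<omega> \<in> Hom2 K f g" "\<sigma> \<in> Hom2 K g k" "\<sigma>' \<in> Hom2 K g k" "\<sigma> \<cdot> \<omega> = \<sigma>' \<cdot> \<omega>"
  shows "\<sigma> = \<sigma>'"
proof -
  obtain \<omega>' where \<omega>': "\<omega>' \<in> Hom2 K g f" "\<omega> \<cdot> \<omega>' = Id2 K g"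
    using assms(1,2) by (rule iso2E)
  have "\<sigma> = (\<sigma> \<cdot> \<omega>) \<cdot> \<omega>'"
    using vcomp_assoc[OF \<omega>'(1) assms(2,3)] \<omega>'(2) vcomp_id_right[OF assms(3)] by simp
  also have "\<dots> = \<sigma>'"
    using vcomp_assoc[OF \<omega>'(1) assms(2,4)] \<omega>'(2) vcomp_id_right[OF assms(4)] assms(5) by simp
  finally show ?thesis .
qed

lemma iso2_whisker_right:
  assumes "iso2 K \<omega>" "\<omega> \<in> Hom2 K f f'" "f \<in> Hom1 K Y Z" "h \<in> Hom1 K X Y"
  shows "iso2 K (\<omega> \<star> Id2 K h)"
proof -
  obtain \<omega>' where \<omega>': "\<omega>' \<in> Hom2 K f' f" "\<omega>' \<cdot> \<omega> = Id2 K f" "\<omega> \<cdot> \<omega>' = Id2 K f'"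
    using assms(1,2) by (rule iso2E)
  have f': "f' \<in> Hom1 K Y Z"
    using assms hom2_tgt by blast
  have hom: "\<omega> \<star> Id2 K h \<in> Hom2 K (f \<odot> h) (f' \<odot> h)" "\<omega>' \<star> Id2 K h \<in> Hom2 K (f' \<odot> h) (f \<odot> h)"
    using assms \<omega>' f' hcomp_hom hom1_id2 by blast+
  have "(\<omega>' \<star> Id2 K h) \<cdot> (\<omega> \<star> Id2 K h) = Id2 K (f \<odot> h)"
    "(\<omega> \<star> Id2 K h) \<cdot> (\<omega>' \<star> Id2 K h) = Id2 K (f' \<odot> h)"
    using vcomp_whisker[OF assms(4,3,2) \<omega>'(1)] vcomp_whisker[OF assms(4) f' \<omega>'(1) assms(2)]
      \<omega>'(2,3) hcomp_id2[OF assms(4,3)] hcomp_id2[OF assms(4) f'] by simp_all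
  with hom show ?thesis
    by (auto simp: iso2_def inverse2_def Hom2_def intro!: exI[of _ "\<omega>' \<star> Id2 K h"])
qed

lemma iso2_whisker_left:
  assumes "iso2 K \<omega>" "\<omega> \<in> Hom2 K h h'" "h \<in> Hom1 K X Y" "f \<in> Hom1 K Y Z"
  shows "iso2 K (Id2 K f \<star> \<omega>)"
proof -
  obtain \<omega>' where \<omega>': "\<omega>' \<in> Hom2 K h' h" "\<omega>' \<cdot> \<omega> = Id2 K h" "\<omega> \<cdot> \<omega>' = Id2 K h'"
    using assms(1,2) by (rule iso2E)
  have h': "h' \<in> Hom1 K X Y"
    using assms hom2_tgt by blast
  have hom: "Id2 K f \<star> \<omega> \<in> Hom2 K (f \<odot> h) (f \<odot> h')" "Id2 K f \<star> \<omega>' \<in> Hom2 K (f \<odot> h') (f \<odot> h)"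
    using assms \<omega>' h' whisker_hom by blast+
  have "(Id2 K f \<star> \<omega>') \<cdot> (Id2 K f \<star> \<omega>) = Id2 K (f \<odot> h)"
    "(Id2 K f \<star> \<omega>) \<cdot> (Id2 K f \<star> \<omega>') = Id2 K (f \<odot> h')"
    using whisker_vcomp[OF assms(3,2) \<omega>'(1) assms(4)] whisker_vcomp[OF h' \<omega>'(1) assms(2,4)]
      \<omega>'(2,3) hcomp_id2[OF assms(3,4)] hcomp_id2[OF h' assms(4)] by simp_all
  with hom show ?thesis
    by (auto simp: iso2_def inverse2_def Hom2_def intro!: exI[of _ "Id2 K f \<star> \<omega>'"])
qed

text \<open>By the exchange law, the invertible cells \<open>\<omega> \<star> Id2 K h\<close> and
  \<open>\<omega> \<star> Id2 K h'\<close> conjugate whiskering with \<open>f\<close> into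
  whiskering with \<open>f'\<close>. This carries an equation of 2-cells across a pseudonaturality
  square or a triangle.\<close>

lemma whisker_eq_iso:
  assumes "iso2 K \<omega>" "\<omega> \<in> Hom2 K f f'" "f \<in> Hom1 K Y Z" "h \<in> Hom1 K X Y"
    and "\<sigma> \<in> Hom2 K h h'" "\<sigma>' \<in> Hom2 K h h'"
  shows "Id2 K f \<star> \<sigma> = Id2 K f \<star> \<sigma>' \<longleftrightarrow> Id2 K f' \<star> \<sigma> = Id2 K f' \<star> \<sigma>'"
proof -
  have f': "f' \<in> Hom1 K Y Z" and h': "h' \<in> Hom1 K X Y"
    using assms hom2_tgt by blast+
  have hom: "\<omega> \<star> Id2 K h \<in> Hom2 K (f \<odot> h) (f' \<odot> h)" "\<omega> \<star> Id2 K h' \<in> Hom2 K (f \<odot> h') (f' \<odot> h')"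
    using assms h' hcomp_hom hom1_id2 by blast+
  have iso: "iso2 K (\<omega> \<star> Id2 K h)" "iso2 K (\<omega> \<star> Id2 K h')"
    using assms h' iso2_whisker_right by blast+
  have w: "Id2 K f \<star> \<sigma> \<in> Hom2 K (f \<odot> h) (f \<odot> h')" "Id2 K f \<star> \<sigma>' \<in> Hom2 K (f \<odot> h) (f \<odot> h')"
    "Id2 K f' \<star> \<sigma> \<in> Hom2 K (f' \<odot> h) (f' \<odot> h')" "Id2 K f' \<star> \<sigma>' \<in> Hom2 K (f' \<odot> h) (f' \<odot> h')"
    using assms f' whisker_hom by blast+
  have "(\<omega> \<star> Id2 K h') \<cdot> (Id2 K f \<star> \<sigma>) = (Id2 K f' \<star> \<sigma>) \<cdot> (\<omega> \<star> Id2 K h)"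
    "(\<omega> \<star> Id2 K h') \<cdot> (Id2 K f \<star> \<sigma>') = (Id2 K f' \<star> \<sigma>') \<cdot> (\<omega> \<star> Id2 K h)"
    using assms whisker_exchange by blast+
  then show ?thesis
    using iso2_cancel_left[OF iso(2) hom(2) w(1,2)] iso2_cancel_right[OF iso(1) hom(1) w(3,4)]
    by auto
qed


section \<open>Faithful and fully faithful 1-cells\<close>

lemma chom_hom_cat: "h \<in> Hom1 K X Y \<Longrightarrow> chom (hom_cat id id K X Y) h h' = Hom2 K h h'"
  by (auto simp: chom_def hom_cat_def Hom2_def)

lemma cobj_hom_cat: "cobj (hom_cat id id K X Y) = Hom1 K X Y"
  by (simp add: hom_cat_def)

lemma on_arr_rep: "f \<in> Hom1 K Y Z \<Longrightarrow> on_arr (rep id id K X) f = post_functor id id K X f"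
  by (simp add: rep_def strict_psf_def Hom1_def)

lemma post_functor_simps:
  assumes "f \<in> Hom1 K Y Z"
  shows "fsrc (post_functor id id K X f) = hom_cat id id K X Y"
    "ftgt (post_functor id id K X f) = hom_cat id id K X Z"
    "h \<in> Hom1 K X Y \<Longrightarrow> fobj (post_functor id id K X f) h = f \<odot> h"
    "h \<in> Hom1 K X Y \<Longrightarrow> \<sigma> \<in> Hom2 K h h' \<Longrightarrow> farr (post_functor id id K X f) \<sigma> = Id2 K f \<star> \<sigma>"
  using assms by (auto simp: post_functor_def hom_cat_def Hom1_def Hom2_def)

text \<open>With both relabellings equal to \<open>id\<close>, the functor represented by
  \<open>f\<close> acts as left whiskering with \<open>f\<close>, so the definition becomes a
  cancellation law between parallel 2-cells.\<close>

lemma faithful1_iff: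
  assumes f: "f \<in> Hom1 K Y Z"
  shows "faithful1 K f \<longleftrightarrow> (\<forall>X\<in>Obj K. \<forall>h\<in>Hom1 K X Y. \<forall>h'\<in>Hom1 K X Y. \<forall>\<sigma>\<in>Hom2 K h h'. \<forall>\<sigma>'\<in>Hom2 K h h'.
    Id2 K f \<star> \<sigma> = Id2 K f \<star> \<sigma>' \<longrightarrow> \<sigma> = \<sigma>')"
proof -
  have "f \<in> Arr K"
    using f by (simp add: Hom1_def)
  then show ?thesis
    by (simp add: faithful1_def faithful_functor_def on_arr_rep[OF f] post_functor_simps[OF f]
        cobj_hom_cat chom_hom_cat inj_on_def)
qed

lemma fully_faithful1_iff:
  assumes f: "f \<in> Hom1 K Y Z"
  shows "fully_faithful1 K f \<longleftrightarrow> faithful1 K f \<and> (\<forall>X\<in>Obj K. \<forall>h\<in>Hom1 K X Y. \<forall>h'\<in>Hom1 K X Y.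
    \<forall>\<theta>\<in>Hom2 K (f \<odot> h) (f \<odot> h'). \<exists>\<sigma>\<in>Hom2 K h h'. Id2 K f \<star> \<sigma> = \<theta>)"
proof -
  have "farr (post_functor id id K X f) ` Hom2 K h h' = Hom2 K (f \<odot> h) (f \<odot> h')
      \<longleftrightarrow> (\<forall>\<theta>\<in>Hom2 K (f \<odot> h) (f \<odot> h'). \<exists>\<sigma>\<in>Hom2 K h h'. Id2 K f \<star> \<sigma> = \<theta>)"
    if h: "h \<in> Hom1 K X Y" for X h h'
  proof -
    have "farr (post_functor id id K X f) ` Hom2 K h h' = (\<lambda>\<sigma>. Id2 K f \<star> \<sigma>) ` Hom2 K h h'"
      using h by (intro image_cong) (auto simp: post_functor_simps[OF f])
    \<comment> \<open>One inclusion holds by typing, so the set equation defining fullness reduces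
      to surjectivity.\<close>
    moreover have "(\<lambda>\<sigma>. Id2 K f \<star> \<sigma>) ` Hom2 K h h' \<subseteq> Hom2 K (f \<odot> h) (f \<odot> h')"
      using whisker_hom[OF h f] by blast
    ultimately have "farr (post_functor id id K X f) ` Hom2 K h h' = Hom2 K (f \<odot> h) (f \<odot> h')
      \<longleftrightarrow> Hom2 K (f \<odot> h) (f \<odot> h') \<subseteq> (\<lambda>\<sigma>. Id2 K f \<star> \<sigma>) ` Hom2 K h h'"
      by auto
    then show ?thesis
      by (simp only: subset_iff image_iff Ball_def eq_commute)
  qed
  then have "full_functor (on_arr (rep id id K X) f) \<longleftrightarrow> (\<forall>h\<in>Hom1 K X Y. \<forall>h'\<in>Hom1 K X Y.
    \<forall>\<theta>\<in>Hom2 K (f \<odot> h) (f \<odot> h'). \<exists>\<sigma>\<in>Hom2 K h h'. Id2 K f \<star> \<sigma> = \<theta>)" for X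
    by (simp add: full_functor_def on_arr_rep[OF f] post_functor_simps[OF f] cobj_hom_cat chom_hom_cat
        comp1_hom[OF _ f])
  then show ?thesis
    by (simp add: fully_faithful1_def faithful1_def ball_conj_distrib)
qed

lemma faithful1D:
  assumes "faithful1 K f" "f \<in> Hom1 K Y Z" "h \<in> Hom1 K X Y" "\<sigma> \<in> Hom2 K h h'" "\<sigma>' \<in> Hom2 K h h'"
    "Id2 K f \<star> \<sigma> = Id2 K f \<star> \<sigma>'"
  shows "\<sigma> = \<sigma>'"
proof -
  have "X \<in> Obj K" using assms(3) dom_cod by (auto simp: Hom1_def)
  with assms show ?thesis using hom2_tgt faithful1_iff[OF assms(2)] by blast
qed

lemma fully_faithful1D:
  assumes "fully_faithful1 K f" "f \<in> Hom1 K Y Z" "h \<in> Hom1 K X Y" "h' \<in> Hom1 K X Y"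
    "\<theta> \<in> Hom2 K (f \<odot> h) (f \<odot> h')"
  obtains \<sigma> where "\<sigma> \<in> Hom2 K h h'" "Id2 K f \<star> \<sigma> = \<theta>"
proof -
  have "X \<in> Obj K" using assms(3) dom_cod by (auto simp: Hom1_def)
  with assms that show ?thesis using fully_faithful1_iff[OF assms(2)] by blast
qed

lemma faithful1I:
  assumes "f \<in> Hom1 K Y Z"
    and "\<And>X h h' \<sigma> \<sigma>'. h \<in> Hom1 K X Y \<Longrightarrow> \<sigma> \<in> Hom2 K h h' \<Longrightarrow> \<sigma>' \<in> Hom2 K h h'
      \<Longrightarrow> Id2 K f \<star> \<sigma> = Id2 K f \<star> \<sigma>' \<Longrightarrow> \<sigma> = \<sigma>'"
  shows "faithful1 K f"
  unfolding faithful1_iff[OF assms(1)] by (intro ballI impI) (rule assms(2))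

lemma fully_faithful1I:
  assumes "f \<in> Hom1 K Y Z" "faithful1 K f"
    and "\<And>X h h' \<theta>. h \<in> Hom1 K X Y \<Longrightarrow> h' \<in> Hom1 K X Y \<Longrightarrow> \<theta> \<in> Hom2 K (f \<odot> h) (f \<odot> h')
      \<Longrightarrow> \<exists>\<sigma>\<in>Hom2 K h h'. Id2 K f \<star> \<sigma> = \<theta>"
  shows "fully_faithful1 K f"
  unfolding fully_faithful1_iff[OF assms(1)] by (intro conjI ballI assms(2)) (rule assms(3))

lemma fully_faithful1_faithful: "fully_faithful1 K f \<Longrightarrow> faithful1 K f"
  by (simp add: fully_faithful1_def faithful1_def)

section \<open>Stability under invertible 2-cells, composites and right factors\<close>

lemma faithful1_iso:
  assumes f: "faithful1 K f" "f \<in> Hom1 K Y Z" and \<omega>: "iso2 K \<omega>" "\<omega> \<in> Hom2 K f f'"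
  shows "faithful1 K f'"
proof (rule faithful1I[OF hom2_tgt[OF \<omega>(2) f(2)]])
  fix X h h' \<sigma> \<sigma>'
  assume h: "h \<in> Hom1 K X Y" and \<sigma>: "\<sigma> \<in> Hom2 K h h'" "\<sigma>' \<in> Hom2 K h h'"
    and "Id2 K f' \<star> \<sigma> = Id2 K f' \<star> \<sigma>'"
  then show "\<sigma> = \<sigma>'"
    using faithful1D[OF f h \<sigma>] whisker_eq_iso[OF \<omega> f(2) h \<sigma>] by simp
qed

lemma fully_faithful1_iso:
  assumes ff: "fully_faithful1 K f" and f: "f \<in> Hom1 K Y Z" and \<omega>: "iso2 K \<omega>" "\<omega> \<in> Hom2 K f f'"
  shows "fully_faithful1 K f'"
proof -
  have f': "f' \<in> Hom1 K Y Z"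
    using f \<omega> hom2_tgt by blast
  have "\<exists>\<sigma>\<in>Hom2 K h h'. Id2 K f' \<star> \<sigma> = \<theta>"
    if h: "h \<in> Hom1 K X Y" "h' \<in> Hom1 K X Y" and \<theta>: "\<theta> \<in> Hom2 K (f' \<odot> h) (f' \<odot> h')" for X h h' \<theta>
  proof -
    have hom: "\<omega> \<star> Id2 K h \<in> Hom2 K (f \<odot> h) (f' \<odot> h)" "\<omega> \<star> Id2 K h' \<in> Hom2 K (f \<odot> h') (f' \<odot> h')"
      using \<omega> f h hcomp_hom hom1_id2 by blast+
    have iso: "iso2 K (\<omega> \<star> Id2 K h)" "iso2 K (\<omega> \<star> Id2 K h')"
      using \<omega> f h iso2_whisker_right by blast+
    \<comment> \<open>To lift \<open>\<theta>\<close> along \<open>f'\<close>, it is conjugated into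
      a 2-cell between composites with \<open>f\<close>, using \<open>\<omega>\<close> on the source
      side and the inverse \<open>\<zeta>\<close> on the target side. The lift along
      \<open>f\<close> then works for \<open>f'\<close> by the exchange law.\<close>
    obtain \<zeta> where \<zeta>: "\<zeta> \<in> Hom2 K (f' \<odot> h') (f \<odot> h')" "(\<omega> \<star> Id2 K h') \<cdot> \<zeta> = Id2 K (f' \<odot> h')"
      using iso(2) hom(2) by (rule iso2E)
    have \<theta>\<omega>: "\<theta> \<cdot> (\<omega> \<star> Id2 K h) \<in> Hom2 K (f \<odot> h) (f' \<odot> h')"
      using \<theta> hom vcomp_hom by blast
    then have "\<zeta> \<cdot> \<theta> \<cdot> (\<omega> \<star> Id2 K h) \<in> Hom2 K (f \<odot> h) (f \<odot> h')"
      using \<zeta> vcomp_hom by blast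
    then obtain \<sigma> where \<sigma>: "\<sigma> \<in> Hom2 K h h'" "Id2 K f \<star> \<sigma> = \<zeta> \<cdot> \<theta> \<cdot> (\<omega> \<star> Id2 K h)"
      using fully_faithful1D[OF ff f h] by blast
    have "(Id2 K f' \<star> \<sigma>) \<cdot> (\<omega> \<star> Id2 K h) = (\<omega> \<star> Id2 K h') \<cdot> \<zeta> \<cdot> \<theta> \<cdot> (\<omega> \<star> Id2 K h)"
      using whisker_exchange[OF h(1) \<sigma>(1) f \<omega>(2)] \<sigma>(2) by simp
    also have "\<dots> = \<theta> \<cdot> (\<omega> \<star> Id2 K h)"
      using vcomp_assoc[OF \<theta>\<omega> \<zeta>(1) hom(2)] \<zeta>(2) vcomp_id_left[OF \<theta>\<omega>] by simp
    finally have "Id2 K f' \<star> \<sigma> = \<theta>"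
      using iso2_cancel_right[OF iso(1) hom(1)] \<theta> whisker_hom[OF h(1) f' \<sigma>(1)] by blast
    with \<sigma> show ?thesis by blast
  qed
  then show ?thesis
    using fully_faithful1I[OF f'] faithful1_iso[OF fully_faithful1_faithful[OF ff] f \<omega>] by blast
qed

lemma faithful1_comp:
  assumes f: "faithful1 K f" "f \<in> Hom1 K X Y" and g: "faithful1 K g" "g \<in> Hom1 K Y Z"
  shows "faithful1 K (g \<odot> f)"
proof (rule faithful1I[OF comp1_hom[OF f(2) g(2)]])
  fix V h h' \<sigma> \<sigma>'
  assume h: "h \<in> Hom1 K V X" and \<sigma>: "\<sigma> \<in> Hom2 K h h'" "\<sigma>' \<in> Hom2 K h h'"
    and "Id2 K (g \<odot> f) \<star> \<sigma> = Id2 K (g \<odot> f) \<star> \<sigma>'"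
  then have "Id2 K g \<star> Id2 K f \<star> \<sigma> = Id2 K g \<star> Id2 K f \<star> \<sigma>'"
    by (simp add: whisker_comp[OF h \<sigma>(1) f(2) g(2)] whisker_comp[OF h \<sigma>(2) f(2) g(2)])
  then have "Id2 K f \<star> \<sigma> = Id2 K f \<star> \<sigma>'"
    using faithful1D[OF g comp1_hom[OF h f(2)]] whisker_hom[OF h f(2)] \<sigma> by blast
  then show "\<sigma> = \<sigma>'"
    using faithful1D[OF f h] \<sigma> by blast
qed

lemma fully_faithful1_comp:
  assumes f: "fully_faithful1 K f" "f \<in> Hom1 K X Y" and g: "fully_faithful1 K g" "g \<in> Hom1 K Y Z"
  shows "fully_faithful1 K (g \<odot> f)"
proof -
  have "\<exists>\<sigma>\<in>Hom2 K h h'. Id2 K (g \<odot> f) \<star> \<sigma> = \<theta>"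
    if h: "h \<in> Hom1 K V X" "h' \<in> Hom1 K V X" and \<theta>: "\<theta> \<in> Hom2 K ((g \<odot> f) \<odot> h) ((g \<odot> f) \<odot> h')" for V h h' \<theta>
  proof -
    have "\<theta> \<in> Hom2 K (g \<odot> f \<odot> h) (g \<odot> f \<odot> h')"
      using \<theta> by (simp add: comp1_assoc[OF h(1) f(2) g(2)] comp1_assoc[OF h(2) f(2) g(2)])
    then obtain \<tau> where \<tau>: "\<tau> \<in> Hom2 K (f \<odot> h) (f \<odot> h')" "Id2 K g \<star> \<tau> = \<theta>"
      using fully_faithful1D[OF g comp1_hom[OF h(1) f(2)] comp1_hom[OF h(2) f(2)]] by blast
    then obtain \<sigma> where \<sigma>: "\<sigma> \<in> Hom2 K h h'" "Id2 K f \<star> \<sigma> = \<tau>"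
      using fully_faithful1D[OF f h] by blast
    with \<tau> show ?thesis
      using whisker_comp[OF h(1) \<sigma>(1) f(2) g(2)] by auto
  qed
  then show ?thesis
    using fully_faithful1I[OF comp1_hom[OF f(2) g(2)]] faithful1_comp[OF _ f(2) _ g(2)]
      fully_faithful1_faithful f(1) g(1) by blast
qed

lemma faithful1_right_factor:
  assumes gf: "faithful1 K (g \<odot> f)" and f: "f \<in> Hom1 K X Y" and g: "g \<in> Hom1 K Y Z"
  shows "faithful1 K f"
proof (rule faithful1I[OF f])
  fix V h h' \<sigma> \<sigma>'
  assume h: "h \<in> Hom1 K V X" and \<sigma>: "\<sigma> \<in> Hom2 K h h'" "\<sigma>' \<in> Hom2 K h h'"
    and "Id2 K f \<star> \<sigma> = Id2 K f \<star> \<sigma>'"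
  then have "Id2 K (g \<odot> f) \<star> \<sigma> = Id2 K (g \<odot> f) \<star> \<sigma>'"
    by (simp add: whisker_comp[OF h \<sigma>(1) f g] whisker_comp[OF h \<sigma>(2) f g])
  then show "\<sigma> = \<sigma>'"
    using faithful1D[OF gf comp1_hom[OF f g] h] \<sigma> by blast
qed

text \<open>The cell \<open>Id2 K g \<star> \<theta>\<close> lifts along \<open>g \<odot> f\<close>
  to some \<open>\<sigma>\<close>. Then \<open>Id2 K f \<star> \<sigma>\<close> and
  \<open>\<theta>\<close> agree after whiskering with \<open>g\<close>, and faithfulness of
  \<open>g\<close> makes them equal.\<close>

lemma fully_faithful1_right_factor:
  assumes gf: "fully_faithful1 K (g \<odot> f)" and f: "f \<in> Hom1 K X Y"
    and g: "faithful1 K g" "g \<in> Hom1 K Y Z"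
  shows "fully_faithful1 K f"
proof -
  have "\<exists>\<sigma>\<in>Hom2 K h h'. Id2 K f \<star> \<sigma> = \<theta>"
    if h: "h \<in> Hom1 K V X" "h' \<in> Hom1 K V X" and \<theta>: "\<theta> \<in> Hom2 K (f \<odot> h) (f \<odot> h')" for V h h' \<theta>
  proof -
    have fh: "f \<odot> h \<in> Hom1 K V Y" using f h comp1_hom by blast
    have "Id2 K g \<star> \<theta> \<in> Hom2 K ((g \<odot> f) \<odot> h) ((g \<odot> f) \<odot> h')"
      using whisker_hom[OF fh g(2) \<theta>] by (simp add: comp1_assoc[OF h(1) f g(2)] comp1_assoc[OF h(2) f g(2)])
    then obtain \<sigma> where \<sigma>: "\<sigma> \<in> Hom2 K h h'" "Id2 K (g \<odot> f) \<star> \<sigma> = Id2 K g \<star> \<theta>"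
      using fully_faithful1D[OF gf comp1_hom[OF f g(2)] h] by blast
    then have "Id2 K f \<star> \<sigma> = \<theta>"
      using faithful1D[OF g fh whisker_hom[OF h(1) f \<sigma>(1)] \<theta>] whisker_comp[OF h(1) \<sigma>(1) f g(2)] by simp
    with \<sigma> show ?thesis by blast
  qed
  then show ?thesis
    using fully_faithful1I[OF f] faithful1_right_factor[OF fully_faithful1_faithful[OF gf] f g(2)]
    by blast
qed

end

section \<open>The 2-category of pseudofunctors\<close>

lemma Hom1_PS:
  "\<alpha> \<in> Hom1 (PS S H) F G \<longleftrightarrow> pseudonatural S H \<alpha> \<and> nsrc \<alpha> = F \<and> ntgt \<alpha> = G"
  by (simp add: Hom1_def PS_def)

lemma Hom2_PS:
  "\<Gamma> \<in> Hom2 (PS S H) \<alpha> \<beta> \<longleftrightarrow> modification S H \<Gamma> \<and> msrc \<Gamma> = \<alpha> \<and> mtgt \<Gamma> = \<beta>"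
  by (simp add: Hom2_def PS_def)

lemma mcomp_PS_hom:
  assumes "\<Gamma> \<in> Hom2 (PS S H) \<alpha> \<beta>" "X \<in> Obj S"
  shows "mcomp \<Gamma> X \<in> Hom2 H (ncomp \<alpha> X) (ncomp \<beta> X)"
  using assms modification.mcomp_hom by (auto simp: Hom2_PS)

lemma ncomp_PS_hom:
  assumes "\<alpha> \<in> Hom1 (PS S H) F G" "X \<in> Obj S"
  shows "ncomp \<alpha> X \<in> Hom1 H (on_obj F X) (on_obj G X)"
  using assms pseudonatural.ncomp_hom by (auto simp: Hom1_PS)

lemma ncomp_PS_comp:
  assumes "X \<in> Obj S"
  shows "ncomp (\<beta> \<odot>\<^bsub>PS S H\<^esub> \<alpha>) X = ncomp \<beta> X \<odot>\<^bsub>H\<^esub> ncomp \<alpha> X"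
  using assms by (simp add: PS_def psnat_comp_def)

lemma mcomp_PS_whisker:
  assumes "X \<in> Obj S"
  shows "mcomp (Id2 (PS S H) \<alpha> \<star>\<^bsub>PS S H\<^esub> \<Gamma>) X = Id2 H (ncomp \<alpha> X) \<star>\<^bsub>H\<^esub> mcomp \<Gamma> X"
  using assms by (simp add: PS_def)

lemma PS_cell_eqI:
  assumes "\<Gamma> \<in> Hom2 (PS S H) \<alpha> \<beta>" "\<Gamma>' \<in> Hom2 (PS S H) \<alpha> \<beta>"
    and "\<And>X. X \<in> Obj S \<Longrightarrow> mcomp \<Gamma> X = mcomp \<Gamma>' X"
  shows "\<Gamma> = \<Gamma>'"
proof -
  have "mcomp \<Gamma> \<in> extensional (Obj S)" "mcomp \<Gamma>' \<in> extensional (Obj S)"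
    using assms(1,2) modification.mcomp_ext unfolding Hom2_PS by blast+
  then have "mcomp \<Gamma> = mcomp \<Gamma>'"
    using assms(3) by (rule extensionalityI)
  then show ?thesis
    using assms(1,2) by (simp add: Hom2_PS)
qed

lemma iso2_mcomp:
  assumes "iso2 (PS S H) \<Gamma>" "\<Gamma> \<in> Hom2 (PS S H) \<alpha> \<beta>" "X \<in> Obj S"
  shows "iso2 H (mcomp \<Gamma> X)"
proof -
  obtain \<Delta> where \<Delta>: "\<Delta> \<in> Hom2 (PS S H) \<beta> \<alpha>" "\<Delta> \<cdot>\<^bsub>PS S H\<^esub> \<Gamma> = Id2 (PS S H) \<alpha>"
    "\<Gamma> \<cdot>\<^bsub>PS S H\<^esub> \<Delta> = Id2 (PS S H) \<beta>"
    using assms(1,2) by (rule iso2E)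
  have "mcomp (\<Delta> \<cdot>\<^bsub>PS S H\<^esub> \<Gamma>) X = mcomp (Id2 (PS S H) \<alpha>) X"
    "mcomp (\<Gamma> \<cdot>\<^bsub>PS S H\<^esub> \<Delta>) X = mcomp (Id2 (PS S H) \<beta>) X"
    using \<Delta> by simp_all
  then have "mcomp \<Delta> X \<cdot>\<^bsub>H\<^esub> mcomp \<Gamma> X = Id2 H (ncomp \<alpha> X)"
    "mcomp \<Gamma> X \<cdot>\<^bsub>H\<^esub> mcomp \<Delta> X = Id2 H (ncomp \<beta> X)"
    using assms(3) by (simp_all add: PS_def)
  with mcomp_PS_hom[OF assms(2,3)] mcomp_PS_hom[OF \<Delta>(1) assms(3)] show ?thesis
    unfolding iso2_def inverse2_def Hom2_def by auto
qed

text \<open>Whiskering of modifications is componentwise and a modification is determined by its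
  components, so the cancellation can be done at each object.\<close>

lemma objectwise_faithful_imp_faithful1_PS:
  assumes PS: "two_category (PS S H)" and H: "two_category H"
    and \<alpha>: "\<alpha> \<in> Hom1 (PS S H) F G" and faithful: "\<And>X. X \<in> Obj S \<Longrightarrow> faithful1 H (ncomp \<alpha> X)"
  shows "faithful1 (PS S H) \<alpha>"
proof (rule two_category.faithful1I[OF PS \<alpha>])
  fix D h h' \<sigma> \<sigma>'
  assume h: "h \<in> Hom1 (PS S H) D F"
    and \<sigma>: "\<sigma> \<in> Hom2 (PS S H) h h'" "\<sigma>' \<in> Hom2 (PS S H) h h'"
    and eq: "Id2 (PS S H) \<alpha> \<star>\<^bsub>PS S H\<^esub> \<sigma> = Id2 (PS S H) \<alpha> \<star>\<^bsub>PS S H\<^esub> \<sigma>'"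
  show "\<sigma> = \<sigma>'"
  proof (rule PS_cell_eqI[OF \<sigma>])
    fix X assume X: "X \<in> Obj S"
    have "Id2 H (ncomp \<alpha> X) \<star>\<^bsub>H\<^esub> mcomp \<sigma> X = Id2 H (ncomp \<alpha> X) \<star>\<^bsub>H\<^esub> mcomp \<sigma>' X"
      using arg_cong[OF eq, of "\<lambda>\<Gamma>. mcomp \<Gamma> X"] by (simp add: mcomp_PS_whisker[OF X])
    then show "mcomp \<sigma> X = mcomp \<sigma>' X"
      using two_category.faithful1D[OF H faithful[OF X] ncomp_PS_hom[OF \<alpha> X] ncomp_PS_hom[OF h X]
          mcomp_PS_hom[OF \<sigma>(1) X] mcomp_PS_hom[OF \<sigma>(2) X]] by blast
  qed
qed


section \<open>Right biadjoints preserve faithful 1-cells\<close>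

lemma (in two_category) Comps_iff:
  "(g, f) \<in> Comps K \<longleftrightarrow> f \<in> Hom1 K (Dom K f) (Cod K f) \<and> g \<in> Hom1 K (Cod K f) (Cod K g)"
  by (auto simp: Comps_def Hom1_def)

lemma Comps_hom: "f \<in> Hom1 K X Y \<Longrightarrow> g \<in> Hom1 K Y Z \<Longrightarrow> (g, f) \<in> Comps K"
  by (auto simp: Comps_def Hom1_def)

text \<open>A pseudofunctor preserves whiskering only up to its compositors. Naturality of
  \<open>comp_con\<close> shows that the two sides agree after composition with the compositor at
  \<open>(f, h')\<close>, which is invertible and cancels.\<close>

lemma (in pseudofunctor) whisker_eq_map:
  assumes h: "h \<in> Hom1 S X Y" and f: "f \<in> Hom1 S Y Z" and \<sigma>: "\<sigma> \<in> Hom2 S h h'" "\<sigma>' \<in> Hom2 S h h'"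
    and eq: "Id2 S f \<star>\<^bsub>S\<^esub> \<sigma> = Id2 S f \<star>\<^bsub>S\<^esub> \<sigma>'"
  shows "Id2 H (on_arr F f) \<star>\<^bsub>H\<^esub> on_cell F \<sigma> = Id2 H (on_arr F f) \<star>\<^bsub>H\<^esub> on_cell F \<sigma>'"
proof -
  have h': "h' \<in> Hom1 S X Y"
    using S.hom2_tgt[OF \<sigma>(1) h] .
  have c: "(f, h) \<in> Comps S" "(f, h') \<in> Comps S"
    using Comps_hom[OF h f] Comps_hom[OF h' f] .
  have "f \<in> Arr S"
    using f by (simp add: Hom1_def)
  then have "comp_con F (f, h') \<cdot>\<^bsub>H\<^esub> (Id2 H (on_arr F f) \<star>\<^bsub>H\<^esub> on_cell F \<sigma>)
      = comp_con F (f, h') \<cdot>\<^bsub>H\<^esub> (Id2 H (on_arr F f) \<star>\<^bsub>H\<^esub> on_cell F \<sigma>')"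
    using comp_con_natural[OF c(1) \<sigma>(1) S.hom1_id2[OF f]] comp_con_natural[OF c(1) \<sigma>(2) S.hom1_id2[OF f]] eq
    by (simp add: map_id2)
  with H.iso2_cancel_left[OF comp_con_iso[OF c(2)] comp_con_hom[OF c(2)]] show ?thesis
    using H.whisker_hom[OF arr_map[OF h] arr_map[OF f] cell_map[OF \<sigma>(1)]]
      H.whisker_hom[OF arr_map[OF h] arr_map[OF f] cell_map[OF \<sigma>(2)]] by blast
qed

text \<open>
  If \<open>R u\<close> identifies \<open>\<sigma>\<close> and \<open>\<sigma>'\<close>, then so does \<open>u\<close> after transposition along the biadjunction,
  since \<open>\<epsilon>\<close> is pseudonatural; and transposition is faithful on 2-cells, since \<open>\<eta>\<close> is pseudonatural
  and the triangle \<open>t\<close> is invertible.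
\<close>

lemma right_biadjoint_faithful1:
  assumes biadj: "biadjunction K M L R \<eta> \<epsilon> s t"
    and u: "u \<in> Hom1 M D E" and faithful: "faithful1 M u"
  shows "faithful1 K (on_arr R u)"
proof -
  interpret K: two_category K using biadj by (simp add: biadjunction_def)
  interpret M: two_category M using biadj by (simp add: biadjunction_def)
  interpret L: pseudofunctor K M L using biadj by (simp add: biadjunction_def)
  interpret R: pseudofunctor M K R using biadj by (simp add: biadjunction_def)
  have \<eta>: "\<eta> \<in> Hom1 (PS K K) (psf_id K) (psf_comp K K R L)"
    and \<epsilon>: "\<epsilon> \<in> Hom1 (PS M M) (psf_comp M M L R) (psf_id M)"
    and t: "t \<in> Hom2 (PS M K) (whisker_left M K R \<epsilon> \<odot>\<^bsub>PS M K\<^esub> whisker_right M K \<eta> R) (Id1 (PS M K) R)"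
      "iso2 (PS M K) t"
    using biadj by (simp_all add: biadjunction_def)
  interpret \<eta>: pseudonatural K K \<eta> using \<eta> by (simp add: Hom1_PS)
  interpret \<epsilon>: pseudonatural M M \<epsilon> using \<epsilon> by (simp add: Hom1_PS)
  have \<eta>_src: "nsrc \<eta> = psf_id K" and \<eta>_tgt: "ntgt \<eta> = psf_comp K K R L"
    using \<eta> by (simp_all add: Hom1_PS)
  have \<epsilon>_src: "nsrc \<epsilon> = psf_comp M M L R" and \<epsilon>_tgt: "ntgt \<epsilon> = psf_id M"
    using \<epsilon> by (simp_all add: Hom1_PS)
  have D: "D \<in> Obj M" and E: "E \<in> Obj M" and uA: "u \<in> Arr M"
    using u M.dom_cod by (auto simp: Hom1_def)
  have Ru: "on_arr R u \<in> Hom1 K (on_obj R D) (on_obj R E)"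
    using R.arr_map[OF u] .
  show ?thesis
  proof (rule K.faithful1I[OF Ru])
    fix X h h' \<sigma> \<sigma>'
    assume h: "h \<in> Hom1 K X (on_obj R D)" and \<sigma>: "\<sigma> \<in> Hom2 K h h'" "\<sigma>' \<in> Hom2 K h h'"
      and eq: "Id2 K (on_arr R u) \<star>\<^bsub>K\<^esub> \<sigma> = Id2 K (on_arr R u) \<star>\<^bsub>K\<^esub> \<sigma>'"
    have X: "X \<in> Obj K" and RD: "on_obj R D \<in> Obj K"
      using h K.dom_cod[of h] R.obj_map[OF D] by (auto simp: Hom1_def)
    have Lh: "on_arr L h \<in> Hom1 M (on_obj L X) (on_obj L (on_obj R D))"
      using L.arr_map[OF h] .
    have L\<sigma>: "on_cell L \<sigma> \<in> Hom2 M (on_arr L h) (on_arr L h')"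
      "on_cell L \<sigma>' \<in> Hom2 M (on_arr L h) (on_arr L h')"
      using L.cell_map \<sigma> by blast+
    have LRu: "on_arr L (on_arr R u) \<in> Hom1 M (on_obj L (on_obj R D)) (on_obj L (on_obj R E))"
      using L.arr_map[OF Ru] .
    have \<epsilon>D: "ncomp \<epsilon> D \<in> Hom1 M (on_obj L (on_obj R D)) D"
      using \<epsilon>.ncomp_hom[OF D] D by (simp add: \<epsilon>_src \<epsilon>_tgt psf_comp_def psf_id_def strict_psf_def)
    have \<epsilon>E: "ncomp \<epsilon> E \<in> Hom1 M (on_obj L (on_obj R E)) E"
      using \<epsilon>.ncomp_hom[OF E] E by (simp add: \<epsilon>_src \<epsilon>_tgt psf_comp_def psf_id_def strict_psf_def)
    have \<epsilon>u: "ncell \<epsilon> u \<in> Hom2 M (u \<odot>\<^bsub>M\<^esub> ncomp \<epsilon> D) (ncomp \<epsilon> E \<odot>\<^bsub>M\<^esub> on_arr L (on_arr R u))"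
      using \<epsilon>.ncell_hom[OF u] uA by (simp add: \<epsilon>_src \<epsilon>_tgt psf_comp_def psf_id_def strict_psf_def)
    have "Id2 M (on_arr L (on_arr R u)) \<star>\<^bsub>M\<^esub> on_cell L \<sigma> = Id2 M (on_arr L (on_arr R u)) \<star>\<^bsub>M\<^esub> on_cell L \<sigma>'"
      by (rule L.whisker_eq_map[OF h Ru \<sigma> eq])
    then have "Id2 M (ncomp \<epsilon> E \<odot>\<^bsub>M\<^esub> on_arr L (on_arr R u)) \<star>\<^bsub>M\<^esub> on_cell L \<sigma>
        = Id2 M (ncomp \<epsilon> E \<odot>\<^bsub>M\<^esub> on_arr L (on_arr R u)) \<star>\<^bsub>M\<^esub> on_cell L \<sigma>'"
      by (simp add: M.whisker_comp[OF Lh L\<sigma>(1) LRu \<epsilon>E] M.whisker_comp[OF Lh L\<sigma>(2) LRu \<epsilon>E])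
    then have "Id2 M (u \<odot>\<^bsub>M\<^esub> ncomp \<epsilon> D) \<star>\<^bsub>M\<^esub> on_cell L \<sigma> = Id2 M (u \<odot>\<^bsub>M\<^esub> ncomp \<epsilon> D) \<star>\<^bsub>M\<^esub> on_cell L \<sigma>'"
      using M.whisker_eq_iso[OF \<epsilon>.ncell_iso[OF uA] \<epsilon>u M.comp1_hom[OF \<epsilon>D u] Lh L\<sigma>] by blast
    then have "Id2 M u \<star>\<^bsub>M\<^esub> Id2 M (ncomp \<epsilon> D) \<star>\<^bsub>M\<^esub> on_cell L \<sigma>
        = Id2 M u \<star>\<^bsub>M\<^esub> Id2 M (ncomp \<epsilon> D) \<star>\<^bsub>M\<^esub> on_cell L \<sigma>'"
      by (simp add: M.whisker_comp[OF Lh L\<sigma>(1) \<epsilon>D u] M.whisker_comp[OF Lh L\<sigma>(2) \<epsilon>D u])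
    \<comment> \<open>These are the transposes of \<open>\<sigma>\<close> and
      \<open>\<sigma>'\<close>. What remains is to undo the transposition by applying
      \<open>R\<close> and precomposing with \<eta>.\<close>
    then have \<epsilon>L\<sigma>: "Id2 M (ncomp \<epsilon> D) \<star>\<^bsub>M\<^esub> on_cell L \<sigma> = Id2 M (ncomp \<epsilon> D) \<star>\<^bsub>M\<^esub> on_cell L \<sigma>'"
      using M.faithful1D[OF faithful u M.comp1_hom[OF Lh \<epsilon>D]
          M.whisker_hom[OF Lh \<epsilon>D L\<sigma>(1)] M.whisker_hom[OF Lh \<epsilon>D L\<sigma>(2)]] by blast
    \<comment> \<open>\<open>e\<close> and \<open>n\<close> are the two 1-cells of the triangle at
      \<open>D\<close>: \<open>t\<close> contracts \<open>e\<close> after \<open>n\<close> to the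
      identity of \<open>on_obj R D\<close>.\<close>
    define e where "e = on_arr R (ncomp \<epsilon> D)"
    define n where "n = ncomp \<eta> (on_obj R D)"
    define RL where "RL \<tau> = on_cell R (on_cell L \<tau>)" for \<tau>
    have e: "e \<in> Hom1 K (on_obj R (on_obj L (on_obj R D))) (on_obj R D)"
      unfolding e_def by (rule R.arr_map[OF \<epsilon>D])
    have n: "n \<in> Hom1 K (on_obj R D) (on_obj R (on_obj L (on_obj R D)))"
      using \<eta>.ncomp_hom[OF RD] RD by (simp add: n_def \<eta>_src \<eta>_tgt psf_comp_def psf_id_def strict_psf_def)
    have eRL: "Id2 K e \<star>\<^bsub>K\<^esub> RL \<sigma> = Id2 K e \<star>\<^bsub>K\<^esub> RL \<sigma>'"
      unfolding e_def RL_def by (rule R.whisker_eq_map[OF Lh \<epsilon>D L\<sigma> \<epsilon>L\<sigma>])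
    have h': "h' \<in> Hom1 K X (on_obj R D)"
      using K.hom2_tgt[OF \<sigma>(1) h] .
    have hA: "h \<in> Arr K" "h' \<in> Arr K"
      using h h' by (simp_all add: Hom1_def)
    define nX where "nX = ncomp \<eta> X"
    have nX: "nX \<in> Hom1 K X (on_obj R (on_obj L X))"
      using \<eta>.ncomp_hom[OF X] X by (simp add: nX_def \<eta>_src \<eta>_tgt psf_comp_def psf_id_def strict_psf_def)
    define RLh where "RLh k = on_arr R (on_arr L k)" for k
    have RLh: "RLh h \<in> Hom1 K (on_obj R (on_obj L X)) (on_obj R (on_obj L (on_obj R D)))"
      unfolding RLh_def by (rule R.arr_map[OF Lh])
    have RLh': "RLh h' \<in> Hom1 K (on_obj R (on_obj L X)) (on_obj R (on_obj L (on_obj R D)))"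
      unfolding RLh_def by (rule R.arr_map[OF L.arr_map[OF h']])
    have \<eta>h: "ncell \<eta> h \<in> Hom2 K (RLh h \<odot>\<^bsub>K\<^esub> nX) (n \<odot>\<^bsub>K\<^esub> h)"
      using \<eta>.ncell_hom[OF h] hA
      by (simp add: RLh_def nX_def n_def \<eta>_src \<eta>_tgt psf_comp_def psf_id_def strict_psf_def)
    have \<eta>h': "ncell \<eta> h' \<in> Hom2 K (RLh h' \<odot>\<^bsub>K\<^esub> nX) (n \<odot>\<^bsub>K\<^esub> h')"
      using \<eta>.ncell_hom[OF h'] hA
      by (simp add: RLh_def nX_def n_def \<eta>_src \<eta>_tgt psf_comp_def psf_id_def strict_psf_def)
    have RL: "RL \<tau> \<in> Hom2 K (RLh h) (RLh h')" if "\<tau> \<in> Hom2 K h h'" for \<tau>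
      unfolding RL_def RLh_def by (rule R.cell_map[OF L.cell_map[OF that]])
    \<comment> \<open>Naturality of \<eta> in the 2-cell \<open>\<tau>\<close>, whiskered with
      \<open>e\<close>. On the right \<open>\<tau>\<close> occurs only through
      \<open>Id2 K e \<star> RL \<tau>\<close>, which by \<open>eRL\<close> is the same for
      \<open>\<sigma>\<close> and \<open>\<sigma>'\<close>.\<close>
    have key: "(Id2 K e \<star>\<^bsub>K\<^esub> Id2 K n \<star>\<^bsub>K\<^esub> \<tau>) \<cdot>\<^bsub>K\<^esub> (Id2 K e \<star>\<^bsub>K\<^esub> ncell \<eta> h)
        = (Id2 K e \<star>\<^bsub>K\<^esub> ncell \<eta> h') \<cdot>\<^bsub>K\<^esub> ((Id2 K e \<star>\<^bsub>K\<^esub> RL \<tau>) \<star>\<^bsub>K\<^esub> Id2 K nX)"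
      if \<tau>: "\<tau> \<in> Hom2 K h h'" for \<tau>
    proof -
      have "\<tau> \<in> Cell K" using \<tau> by (simp add: Hom2_def)
      then have nat: "ncell \<eta> h' \<cdot>\<^bsub>K\<^esub> (RL \<tau> \<star>\<^bsub>K\<^esub> Id2 K nX) = (Id2 K n \<star>\<^bsub>K\<^esub> \<tau>) \<cdot>\<^bsub>K\<^esub> ncell \<eta> h"
        using \<eta>.ncell_natural[OF h \<tau>]
        by (simp add: RL_def nX_def n_def \<eta>_src \<eta>_tgt psf_comp_def psf_id_def strict_psf_def)
      have w: "RL \<tau> \<star>\<^bsub>K\<^esub> Id2 K nX \<in> Hom2 K (RLh h \<odot>\<^bsub>K\<^esub> nX) (RLh h' \<odot>\<^bsub>K\<^esub> nX)"
        using K.hcomp_hom[OF nX RLh K.hom1_id2[OF nX] RL[OF \<tau>]] .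
      have "(Id2 K e \<star>\<^bsub>K\<^esub> Id2 K n \<star>\<^bsub>K\<^esub> \<tau>) \<cdot>\<^bsub>K\<^esub> (Id2 K e \<star>\<^bsub>K\<^esub> ncell \<eta> h)
          = Id2 K e \<star>\<^bsub>K\<^esub> ((Id2 K n \<star>\<^bsub>K\<^esub> \<tau>) \<cdot>\<^bsub>K\<^esub> ncell \<eta> h)"
        using K.whisker_vcomp[OF K.comp1_hom[OF nX RLh] \<eta>h K.whisker_hom[OF h n \<tau>] e] by simp
      also have "\<dots> = (Id2 K e \<star>\<^bsub>K\<^esub> ncell \<eta> h') \<cdot>\<^bsub>K\<^esub> (Id2 K e \<star>\<^bsub>K\<^esub> RL \<tau> \<star>\<^bsub>K\<^esub> Id2 K nX)"
        using K.whisker_vcomp[OF K.comp1_hom[OF nX RLh] w \<eta>h' e] nat by simp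
      finally show ?thesis
        using K.hcomp_assoc[OF nX RLh e K.hom1_id2[OF nX] RL[OF \<tau>] K.hom1_id2[OF e]] by simp
    qed
    have e\<eta>h: "Id2 K e \<star>\<^bsub>K\<^esub> ncell \<eta> h \<in> Hom2 K (e \<odot>\<^bsub>K\<^esub> RLh h \<odot>\<^bsub>K\<^esub> nX) (e \<odot>\<^bsub>K\<^esub> n \<odot>\<^bsub>K\<^esub> h)"
      using K.whisker_hom[OF K.comp1_hom[OF nX RLh] e \<eta>h] .
    have e\<eta>h_iso: "iso2 K (Id2 K e \<star>\<^bsub>K\<^esub> ncell \<eta> h)"
      using K.iso2_whisker_left[OF \<eta>.ncell_iso[OF hA(1)] \<eta>h K.comp1_hom[OF nX RLh] e] .
    have "(Id2 K e \<star>\<^bsub>K\<^esub> Id2 K n \<star>\<^bsub>K\<^esub> \<sigma>) \<cdot>\<^bsub>K\<^esub> (Id2 K e \<star>\<^bsub>K\<^esub> ncell \<eta> h)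
        = (Id2 K e \<star>\<^bsub>K\<^esub> Id2 K n \<star>\<^bsub>K\<^esub> \<sigma>') \<cdot>\<^bsub>K\<^esub> (Id2 K e \<star>\<^bsub>K\<^esub> ncell \<eta> h)"
      using key[OF \<sigma>(1)] key[OF \<sigma>(2)] eRL by simp
    then have "Id2 K e \<star>\<^bsub>K\<^esub> Id2 K n \<star>\<^bsub>K\<^esub> \<sigma> = Id2 K e \<star>\<^bsub>K\<^esub> Id2 K n \<star>\<^bsub>K\<^esub> \<sigma>'"
      using K.iso2_cancel_right[OF e\<eta>h_iso e\<eta>h
          K.whisker_hom[OF K.comp1_hom[OF h n] e K.whisker_hom[OF h n \<sigma>(1)]]
          K.whisker_hom[OF K.comp1_hom[OF h n] e K.whisker_hom[OF h n \<sigma>(2)]]] by blast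
    then have en\<sigma>: "Id2 K (e \<odot>\<^bsub>K\<^esub> n) \<star>\<^bsub>K\<^esub> \<sigma> = Id2 K (e \<odot>\<^bsub>K\<^esub> n) \<star>\<^bsub>K\<^esub> \<sigma>'"
      by (simp add: K.whisker_comp[OF h \<sigma>(1) n e] K.whisker_comp[OF h \<sigma>(2) n e])
    have tD: "mcomp t D \<in> Hom2 K (e \<odot>\<^bsub>K\<^esub> n) (Id1 K (on_obj R D))"
      using mcomp_PS_hom[OF t(1) D] D
      by (simp add: ncomp_PS_comp[OF D] e_def n_def whisker_left_def whisker_right_def)
        (simp add: PS_def)
    have "Id2 K (Id1 K (on_obj R D)) \<star>\<^bsub>K\<^esub> \<sigma> = Id2 K (Id1 K (on_obj R D)) \<star>\<^bsub>K\<^esub> \<sigma>'"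
      using K.whisker_eq_iso[OF iso2_mcomp[OF t(2,1) D] tD K.comp1_hom[OF n e] h \<sigma>] en\<sigma> by blast
    then show "\<sigma> = \<sigma>'"
      by (simp add: K.hcomp_id_left[OF h \<sigma>(1)] K.hcomp_id_left[OF h \<sigma>(2)])
  qed
qed

section \<open>Evaluation at an initial object\<close>

text \<open>For an initial object \<open>z\<close> all hom-categories out of \<open>z\<close> are
  terminal, so the copower of the representable at \<open>z\<close> with \<open>X\<close> is this
  constant pseudofunctor. By the bicategorical Yoneda lemma, maps out of it correspond to maps from
  \<open>X\<close> to the value at \<open>z\<close>.\<close>

definition const_psf :: "('o, 'a, 'c) twocat \<Rightarrow> ('p, 'b, 'd) twocat \<Rightarrow> 'p \<Rightarrow> ('o, 'a, 'c, 'p, 'b, 'd) psfun" where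
  "const_psf S H X = strict_psf S H (\<lambda>_. X) (\<lambda>_. Id1 H X) (\<lambda>_. Id2 H (Id1 H X))"

lemma (in two_category) iso2_Id2: "f \<in> Hom1 K X Y \<Longrightarrow> iso2 K (Id2 K f)"
  using hom1_id2[of f X Y] vcomp_id_left[OF hom1_id2[of f X Y]]
  by (auto simp: iso2_def inverse2_def Hom2_def intro!: exI[of _ "Id2 K f"])

lemma pseudofunctor_const:
  assumes S: "two_category S" and H: "two_category H" and X: "X \<in> Obj H"
  shows "pseudofunctor S H (const_psf S H X)"
proof -
  interpret S: two_category S by fact
  interpret H: two_category H by fact
  have I: "Id1 H X \<in> Hom1 H X X"
    using X by (rule H.id1_hom)
  have II: "Id2 H (Id1 H X) \<in> Hom2 H (Id1 H X) (Id1 H X)"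
    using I by (rule H.hom1_id2)
  have I_comp: "Id1 H X \<odot>\<^bsub>H\<^esub> Id1 H X = Id1 H X"
    using I by (rule H.comp1_id_left)
  have II_vcomp: "Id2 H (Id1 H X) \<cdot>\<^bsub>H\<^esub> Id2 H (Id1 H X) = Id2 H (Id1 H X)"
    using II by (rule H.vcomp_id_left)
  have II_hcomp: "Id2 H (Id1 H X) \<star>\<^bsub>H\<^esub> Id2 H (Id1 H X) = Id2 H (Id1 H X)"
    using H.hcomp_id_left[OF I II] .
  have iso: "iso2 H (Id2 H (Id1 H X))"
    using I by (rule H.iso2_Id2)
  \<comment> \<open>The maps in \<open>const_psf\<close> are restricted to the carriers of
    \<open>S\<close>. Each axiom therefore needs its composites and identities to lie in those
    carriers before it reduces to a law for the identity 2-cell on \<open>Id1 H X\<close>.\<close>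
  have comp: "g \<odot>\<^bsub>S\<^esub> f \<in> Arr S" "f \<in> Arr S" "g \<in> Arr S" if "(g, f) \<in> Comps S" for g f
    using that S.comp1_hom unfolding S.Comps_iff by (auto simp: Hom1_def)
  have comp_l: "(h \<odot>\<^bsub>S\<^esub> g, f) \<in> Comps S" "(h, g \<odot>\<^bsub>S\<^esub> f) \<in> Comps S"
    if "(h, g) \<in> Comps S" "(g, f) \<in> Comps S" for h g f
    using that S.comp1_hom[of g "Dom S g" "Cod S g" h "Cod S h"]
      S.comp1_hom[of f "Dom S f" "Cod S f" g "Cod S g"]
    by (auto simp: Comps_def Hom1_def)
  have cell: "\<sigma> \<in> Cell S" "f \<in> Arr S" "g \<in> Arr S" if "\<sigma> \<in> Hom2 S f g" for \<sigma> f g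
    using that S.src_tgt[of \<sigma>] by (auto simp: Hom2_def)
  have vc: "\<tau> \<cdot>\<^bsub>S\<^esub> \<sigma> \<in> Cell S" if "\<sigma> \<in> Hom2 S f g" "\<tau> \<in> Hom2 S g h" for \<sigma> \<tau> f g h
    using S.vcomp_hom[OF that] by (simp add: Hom2_def)
  have c2: "(g', f') \<in> Comps S" "\<tau> \<star>\<^bsub>S\<^esub> \<sigma> \<in> Cell S"
    if gf: "(g, f) \<in> Comps S" and \<sigma>: "\<sigma> \<in> Hom2 S f f'" and \<tau>: "\<tau> \<in> Hom2 S g g'" for \<sigma> \<tau> f f' g g'
  proof -
    have f: "f \<in> Hom1 S (Dom S f) (Cod S f)" and g: "g \<in> Hom1 S (Cod S f) (Cod S g)"
      using gf unfolding S.Comps_iff by blast+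
    show "(g', f') \<in> Comps S"
      using Comps_hom[OF S.hom2_tgt[OF \<sigma> f] S.hom2_tgt[OF \<tau> g]] .
    show "\<tau> \<star>\<^bsub>S\<^esub> \<sigma> \<in> Cell S"
      using S.hcomp_hom[OF f g \<sigma> \<tau>] by (simp add: Hom2_def)
  qed
  have u: "(f, Id1 S Y) \<in> Comps S" "(Id1 S Z, f) \<in> Comps S" "f \<in> Arr S" "Y \<in> Obj S" "Z \<in> Obj S"
    if f: "f \<in> Hom1 S Y Z" for f Y Z
  proof -
    show "f \<in> Arr S" "Y \<in> Obj S" "Z \<in> Obj S"
      using f S.dom_cod by (auto simp: Hom1_def)
    then show "(f, Id1 S Y) \<in> Comps S" "(Id1 S Z, f) \<in> Comps S"
      using Comps_hom[OF S.id1_hom f] Comps_hom[OF f S.id1_hom] by blast+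
  qed
  have id2: "Id2 S f \<in> Cell S" if "f \<in> Arr S" for f
    using S.id2_hom[OF that] by (simp add: Hom2_def)
  have id1: "Id1 S Y \<in> Arr S" if "Y \<in> Obj S" for Y
    using S.id1_hom[OF that] by (simp add: Hom1_def)
  show ?thesis
    by unfold_locales
      (simp_all add: const_psf_def strict_psf_def I II I_comp II_vcomp II_hcomp X comp comp_l cell vc c2 u id2 id1 iso
        cong: conj_cong)
qed

text \<open>
  A 1-cell \<open>h : X \<rightarrow> F z\<close> out of the value of \<open>F\<close> at an initial object \<open>z\<close> extends to a pseudonatural
  transformation from the constant pseudofunctor at \<open>X\<close>, and 2-cells extend to modifications.
\<close>

locale psf_at_initial = pseudofunctor S H F
  for S :: "('o, 'a, 'c) twocat" and H :: "('p, 'b, 'd) twocat"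
    and F :: "('o, 'a, 'c, 'p, 'b, 'd) psfun" +
  fixes z :: 'o and init :: "'o \<Rightarrow> 'a"
  assumes init_obj: "z \<in> Obj S"
    and init_hom1: "Y \<in> Obj S \<Longrightarrow> Hom1 S z Y = {init Y}"
    and init_hom2: "Y \<in> Obj S \<Longrightarrow> Hom2 S (init Y) (init Y) = {Id2 S (init Y)}"
begin

text \<open>Since \<open>f \<odot> init Y\<close> equals \<open>init Z\<close> strictly, the
  compositor of \<open>F\<close> at \<open>(f, init Y)\<close> already ends in
  \<open>F (init Z)\<close>, and whiskering it with \<open>h\<close> gives the square at
  \<open>f\<close>. The vertex of the constant source is recovered as
  \<open>Dom H h\<close>.\<close>

definition extend1 :: "'b \<Rightarrow> ('o, 'a, 'c, 'p, 'b, 'd) psnat" where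
  "extend1 h =
     \<lparr>nsrc = const_psf S H (Dom H h), ntgt = F,
      ncomp = (\<lambda>Y\<in>Obj S. on_arr F (init Y) \<odot>\<^bsub>H\<^esub> h),
      ncell = (\<lambda>f\<in>Arr S. comp_con F (f, init (Dom S f)) \<star>\<^bsub>H\<^esub> Id2 H h)\<rparr>"

definition extend2 :: "'d \<Rightarrow> ('o, 'a, 'c, 'p, 'b, 'd) psmod" where
  "extend2 \<sigma> =
     \<lparr>msrc = extend1 (Src H \<sigma>), mtgt = extend1 (Tgt H \<sigma>),
      mcomp = (\<lambda>Y\<in>Obj S. Id2 H (on_arr F (init Y)) \<star>\<^bsub>H\<^esub> \<sigma>)\<rparr>"

lemma init_hom: "Y \<in> Obj S \<Longrightarrow> init Y \<in> Hom1 S z Y"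
  by (simp add: init_hom1)

lemma comp_init: "f \<in> Hom1 S Y Z \<Longrightarrow> f \<odot>\<^bsub>S\<^esub> init Y = init Z"
proof -
  assume f: "f \<in> Hom1 S Y Z"
  then have Y: "Y \<in> Obj S" and Z: "Z \<in> Obj S"
    using S.dom_cod by (auto simp: Hom1_def)
  show ?thesis
    using S.comp1_hom[OF init_hom[OF Y] f] init_hom1[OF Z] by blast
qed

lemma comp_con_init:
  assumes f: "f \<in> Hom1 S Y Z"
  shows "comp_con F (f, init Y) \<in> Hom2 H (on_arr F f \<odot>\<^bsub>H\<^esub> on_arr F (init Y)) (on_arr F (init Z))"
    "iso2 H (comp_con F (f, init Y))" "(f, init Y) \<in> Comps S"
    "on_arr F (init Y) \<in> Hom1 H (on_obj F z) (on_obj F Y)"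
    "on_arr F (init Z) \<in> Hom1 H (on_obj F z) (on_obj F Z)"
    "on_arr F f \<in> Hom1 H (on_obj F Y) (on_obj F Z)"
    "f \<in> Arr S" "Dom S f = Y" "Y \<in> Obj S" "Z \<in> Obj S"
proof -
  show YZ: "Y \<in> Obj S" "Z \<in> Obj S" "f \<in> Arr S" "Dom S f = Y"
    using f S.dom_cod by (auto simp: Hom1_def)
  show c: "(f, init Y) \<in> Comps S"
    using Comps_hom[OF init_hom[OF YZ(1)] f] .
  show "comp_con F (f, init Y) \<in> Hom2 H (on_arr F f \<odot>\<^bsub>H\<^esub> on_arr F (init Y)) (on_arr F (init Z))"
    using comp_con_hom[OF c] by (simp add: comp_init[OF f])
  show "iso2 H (comp_con F (f, init Y))"
    using comp_con_iso[OF c] .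
  show "on_arr F (init Y) \<in> Hom1 H (on_obj F z) (on_obj F Y)"
    "on_arr F (init Z) \<in> Hom1 H (on_obj F z) (on_obj F Z)"
    "on_arr F f \<in> Hom1 H (on_obj F Y) (on_obj F Z)"
    using arr_map init_hom YZ f by blast+
qed

text \<open>Each axiom is a law of \<open>F\<close> at a 1-cell out of \<open>z\<close>, whiskered
  with \<open>h\<close>: naturality comes from \<open>comp_con_natural\<close>, composition from
  \<open>assoc_coherence\<close>, and the unit axiom from
  \<open>unit_left_coherence\<close>.\<close>

lemma pseudonatural_extend1:
  assumes h: "h \<in> Hom1 H X (on_obj F z)"
  shows "pseudonatural S H (extend1 h)"
proof -
  have X: "X \<in> Obj H" and DX: "Dom H h = X"
    using h H.dom_cod by (auto simp: Hom1_def)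
  have I: "Id1 H X \<in> Hom1 H X X"
    using X by (rule H.id1_hom)
  have Ih: "Id2 H h \<in> Hom2 H h h"
    using h by (rule H.hom1_id2)
  have [simp]: "nsrc (extend1 h) = const_psf S H X" "ntgt (extend1 h) = F"
    by (simp_all add: extend1_def DX)
  have const: "on_obj (const_psf S H X) Y = X" if "Y \<in> Obj S" for Y
    using that by (simp add: const_psf_def strict_psf_def)
  have const1: "on_arr (const_psf S H X) f = Id1 H X" if "f \<in> Arr S" for f
    using that by (simp add: const_psf_def strict_psf_def)
  have comp: "ncomp (extend1 h) Y = on_arr F (init Y) \<odot>\<^bsub>H\<^esub> h" if "Y \<in> Obj S" for Y
    using that by (simp add: extend1_def)
  have cell: "ncell (extend1 h) f = comp_con F (f, init Y) \<star>\<^bsub>H\<^esub> Id2 H h" if "f \<in> Hom1 S Y Z" for f Y Z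
    using comp_con_init(7,8)[OF that] by (simp add: extend1_def)
  have Fh: "on_arr F (init Y) \<odot>\<^bsub>H\<^esub> h \<in> Hom1 H X (on_obj F Y)" if "Y \<in> Obj S" for Y
    using H.comp1_hom[OF h arr_map[OF init_hom[OF that]]] .
  have Fh_id: "(on_arr F (init Y) \<odot>\<^bsub>H\<^esub> h) \<odot>\<^bsub>H\<^esub> Id1 H X = on_arr F (init Y) \<odot>\<^bsub>H\<^esub> h" if "Y \<in> Obj S" for Y
    using H.comp1_id_right[OF Fh[OF that]] .
  have cell_hom: "comp_con F (f, init Y) \<star>\<^bsub>H\<^esub> Id2 H h
      \<in> Hom2 H (on_arr F f \<odot>\<^bsub>H\<^esub> on_arr F (init Y) \<odot>\<^bsub>H\<^esub> h) (on_arr F (init Z) \<odot>\<^bsub>H\<^esub> h)"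
    if f: "f \<in> Hom1 S Y Z" for f Y Z
    using H.hcomp_hom[OF h H.comp1_hom[OF comp_con_init(4,6)[OF f]] Ih comp_con_init(1)[OF f]]
      H.comp1_assoc[OF h comp_con_init(4,6)[OF f]] by simp
  have id_split: "Id2 H (on_arr F (init Y) \<odot>\<^bsub>H\<^esub> h) = Id2 H (on_arr F (init Y)) \<star>\<^bsub>H\<^esub> Id2 H h" if "Y \<in> Obj S" for Y
    using H.hcomp_id2[OF h arr_map[OF init_hom[OF that]]] by simp
  \<comment> \<open>Every component ends in \<open>h\<close>; this fact and \<open>vcomp_h\<close>
    pull that factor out, leaving a law of \<open>F\<close> alone.\<close>
  have whisker_split: "\<sigma> \<star>\<^bsub>H\<^esub> Id2 H (on_arr F (init Y) \<odot>\<^bsub>H\<^esub> h) = (\<sigma> \<star>\<^bsub>H\<^esub> Id2 H (on_arr F (init Y))) \<star>\<^bsub>H\<^esub> Id2 H h"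
    if Y: "Y \<in> Obj S" and k: "k \<in> Hom1 H (on_obj F Y) V" and \<sigma>: "\<sigma> \<in> Hom2 H k k'" for Y \<sigma> k k' V
    using H.hcomp_assoc[OF h arr_map[OF init_hom[OF Y]] k Ih H.hom1_id2[OF arr_map[OF init_hom[OF Y]]] \<sigma>]
    by (simp add: id_split[OF Y])
  have vcomp_h: "(\<tau> \<star>\<^bsub>H\<^esub> Id2 H h) \<cdot>\<^bsub>H\<^esub> (\<sigma> \<star>\<^bsub>H\<^esub> Id2 H h) = (\<tau> \<cdot>\<^bsub>H\<^esub> \<sigma>) \<star>\<^bsub>H\<^esub> Id2 H h"
    if "k \<in> Hom1 H (on_obj F z) V" "\<sigma> \<in> Hom2 H k k'" "\<tau> \<in> Hom2 H k' k''" for k k' k'' \<sigma> \<tau> V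
    using H.vcomp_whisker[OF h that] by simp
  interpret C: pseudofunctor S H "const_psf S H X"
    using pseudofunctor_const[OF S.two_category_axioms H.two_category_axioms X] .
  show ?thesis
  proof (intro pseudonatural.intro pseudonatural_axioms.intro,
      simp_all only: \<open>nsrc (extend1 h) = const_psf S H X\<close> \<open>ntgt (extend1 h) = F\<close>)
    show "pseudofunctor S H (const_psf S H X)" "pseudofunctor S H F"
      by unfold_locales
    show "ncomp (extend1 h) \<in> extensional (Obj S)" "ncell (extend1 h) \<in> extensional (Arr S)"
      by (simp_all add: extend1_def)
    show "ncomp (extend1 h) Y \<in> Hom1 H (on_obj (const_psf S H X) Y) (on_obj F Y)" if "Y \<in> Obj S" for Y
      using Fh[OF that] by (simp add: comp[OF that] const[OF that])
    show "ncell (extend1 h) f \<in> Hom2 H (on_arr F f \<odot>\<^bsub>H\<^esub> ncomp (extend1 h) Y)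
        (ncomp (extend1 h) Z \<odot>\<^bsub>H\<^esub> on_arr (const_psf S H X) f)" if f: "f \<in> Hom1 S Y Z" for f Y Z
      using cell_hom[OF f] comp_con_init(7,9,10)[OF f]
      by (simp add: cell[OF f] comp const1 Fh_id)
    show "iso2 H (ncell (extend1 h) f)" if "f \<in> Arr S" for f
    proof -
      have f: "f \<in> Hom1 S (Dom S f) (Cod S f)"
        using that by (simp add: Hom1_def)
      show ?thesis
        using H.iso2_whisker_right[OF comp_con_init(2,1)[OF f] H.comp1_hom[OF comp_con_init(4,6)[OF f]] h]
        by (simp add: cell[OF f])
    qed
    show "ncell (extend1 h) f' \<cdot>\<^bsub>H\<^esub> (on_cell F \<sigma> \<star>\<^bsub>H\<^esub> Id2 H (ncomp (extend1 h) Y))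
        = (Id2 H (ncomp (extend1 h) Z) \<star>\<^bsub>H\<^esub> on_cell (const_psf S H X) \<sigma>) \<cdot>\<^bsub>H\<^esub> ncell (extend1 h) f"
      if f: "f \<in> Hom1 S Y Z" and \<sigma>: "\<sigma> \<in> Hom2 S f f'" for f f' Y Z \<sigma>
    proof -
      note i = comp_con_init[OF f]
      have f': "f' \<in> Hom1 S Y Z"
        using S.hom2_tgt[OF \<sigma> f] .
      have iY: "Id2 S (init Y) \<in> Hom2 S (init Y) (init Y)" "init Y \<in> Arr S"
        using S.hom1_id2[OF init_hom[OF i(9)]] init_hom[OF i(9)] by (simp_all add: Hom1_def)
      \<comment> \<open>The 2-dimensional part of initiality: this whiskered cell is an endomorphism
        of \<open>init Z\<close>, hence an identity.\<close>
      have "\<sigma> \<star>\<^bsub>S\<^esub> Id2 S (init Y) \<in> Hom2 S (init Z) (init Z)"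
        using S.hcomp_hom[OF init_hom[OF i(9)] f iY(1) \<sigma>] by (simp add: comp_init[OF f] comp_init[OF f'])
      then have "\<sigma> \<star>\<^bsub>S\<^esub> Id2 S (init Y) = Id2 S (init Z)"
        by (simp add: init_hom2[OF i(10)])
      moreover have "init Z \<in> Arr S"
        using init_hom[OF i(10)] by (simp add: Hom1_def)
      ultimately have nat: "comp_con F (f', init Y) \<cdot>\<^bsub>H\<^esub> (on_cell F \<sigma> \<star>\<^bsub>H\<^esub> Id2 H (on_arr F (init Y)))
          = comp_con F (f, init Y)"
        using comp_con_natural[OF i(3) iY(1) \<sigma>] by (simp add: map_id2 iY(2) H.vcomp_id_left[OF i(1)])
      have F\<sigma>: "on_cell F \<sigma> \<in> Hom2 H (on_arr F f) (on_arr F f')"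
        using cell_map[OF \<sigma>] .
      have "ncell (extend1 h) f' \<cdot>\<^bsub>H\<^esub> (on_cell F \<sigma> \<star>\<^bsub>H\<^esub> Id2 H (ncomp (extend1 h) Y))
          = (comp_con F (f', init Y) \<star>\<^bsub>H\<^esub> Id2 H h)
            \<cdot>\<^bsub>H\<^esub> ((on_cell F \<sigma> \<star>\<^bsub>H\<^esub> Id2 H (on_arr F (init Y))) \<star>\<^bsub>H\<^esub> Id2 H h)"
        by (simp add: cell[OF f'] comp[OF i(9)] whisker_split[OF i(9,6) F\<sigma>])
      also have "\<dots> = comp_con F (f, init Y) \<star>\<^bsub>H\<^esub> Id2 H h"
        using vcomp_h[OF H.comp1_hom[OF i(4,6)] H.hcomp_hom[OF i(4,6) H.hom1_id2[OF i(4)] F\<sigma>]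
            comp_con_init(1)[OF f']] nat by simp
      also have "\<dots> = Id2 H (on_arr F (init Z) \<odot>\<^bsub>H\<^esub> h) \<cdot>\<^bsub>H\<^esub> (comp_con F (f, init Y) \<star>\<^bsub>H\<^esub> Id2 H h)"
        using H.vcomp_id_left[OF cell_hom[OF f]] by simp
      also have "Id2 H (on_arr F (init Z) \<odot>\<^bsub>H\<^esub> h)
          = Id2 H (on_arr F (init Z) \<odot>\<^bsub>H\<^esub> h) \<star>\<^bsub>H\<^esub> Id2 H (Id1 H X)"
        using H.hcomp_id_right[OF Fh[OF i(10)] H.hom1_id2[OF Fh[OF i(10)]]] by simp
      also have "Id2 H (Id1 H X) = on_cell (const_psf S H X) \<sigma>"
        using \<sigma> by (simp add: const_psf_def strict_psf_def Hom2_def)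
      finally show ?thesis
        by (simp add: cell[OF f] comp[OF i(10)])
    qed
    show "ncell (extend1 h) (g \<odot>\<^bsub>S\<^esub> f) \<cdot>\<^bsub>H\<^esub> (comp_con F (g, f) \<star>\<^bsub>H\<^esub> Id2 H (ncomp (extend1 h) Y))
        = (Id2 H (ncomp (extend1 h) V) \<star>\<^bsub>H\<^esub> comp_con (const_psf S H X) (g, f))
          \<cdot>\<^bsub>H\<^esub> (ncell (extend1 h) g \<star>\<^bsub>H\<^esub> Id2 H (on_arr (const_psf S H X) f))
          \<cdot>\<^bsub>H\<^esub> (Id2 H (on_arr F g) \<star>\<^bsub>H\<^esub> ncell (extend1 h) f)"
      if f: "f \<in> Hom1 S Y Z" and g: "g \<in> Hom1 S Z V" for f g Y Z V
    proof -
      note i = comp_con_init[OF f]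
      note j = comp_con_init[OF g]
      have gf: "g \<odot>\<^bsub>S\<^esub> f \<in> Hom1 S Y V" and c: "(g, f) \<in> Comps S"
        using S.comp1_hom[OF f g] Comps_hom[OF f g] .
      note k = comp_con_init[OF gf]
      have cgf: "comp_con F (g, f) \<in> Hom2 H (on_arr F g \<odot>\<^bsub>H\<^esub> on_arr F f) (on_arr F (g \<odot>\<^bsub>S\<^esub> f))"
        using comp_con_hom[OF c] .
      have g_cell: "Id2 H (on_arr F g) \<star>\<^bsub>H\<^esub> comp_con F (f, init Y)
          \<in> Hom2 H (on_arr F g \<odot>\<^bsub>H\<^esub> on_arr F f \<odot>\<^bsub>H\<^esub> on_arr F (init Y)) (on_arr F g \<odot>\<^bsub>H\<^esub> on_arr F (init Z))"
        using H.whisker_hom[OF H.comp1_hom[OF i(4,6)] j(6) i(1)] .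
      have "ncell (extend1 h) (g \<odot>\<^bsub>S\<^esub> f) \<cdot>\<^bsub>H\<^esub> (comp_con F (g, f) \<star>\<^bsub>H\<^esub> Id2 H (ncomp (extend1 h) Y))
          = (comp_con F (g \<odot>\<^bsub>S\<^esub> f, init Y) \<star>\<^bsub>H\<^esub> Id2 H h)
            \<cdot>\<^bsub>H\<^esub> ((comp_con F (g, f) \<star>\<^bsub>H\<^esub> Id2 H (on_arr F (init Y))) \<star>\<^bsub>H\<^esub> Id2 H h)"
        by (simp add: cell[OF gf] comp[OF i(9)] whisker_split[OF i(9) H.comp1_hom[OF i(6) j(6)] cgf])
      also have "\<dots> = (comp_con F (g \<odot>\<^bsub>S\<^esub> f, init Y) \<cdot>\<^bsub>H\<^esub> (comp_con F (g, f) \<star>\<^bsub>H\<^esub> Id2 H (on_arr F (init Y)))) \<star>\<^bsub>H\<^esub> Id2 H h"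
        using vcomp_h[OF H.comp1_hom[OF i(4) H.comp1_hom[OF i(6) j(6)]]
            H.hcomp_hom[OF i(4) H.comp1_hom[OF i(6) j(6)] H.hom1_id2[OF i(4)] cgf] k(1)] .
      also have "\<dots> = (comp_con F (g, init Z) \<cdot>\<^bsub>H\<^esub> (Id2 H (on_arr F g) \<star>\<^bsub>H\<^esub> comp_con F (f, init Y))) \<star>\<^bsub>H\<^esub> Id2 H h"
        using assoc_coherence[OF c i(3)] by (simp add: comp_init[OF f])
      also have "\<dots> = (comp_con F (g, init Z) \<star>\<^bsub>H\<^esub> Id2 H h)
          \<cdot>\<^bsub>H\<^esub> ((Id2 H (on_arr F g) \<star>\<^bsub>H\<^esub> comp_con F (f, init Y)) \<star>\<^bsub>H\<^esub> Id2 H h)"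
        using vcomp_h[OF H.comp1_hom[OF H.comp1_hom[OF i(4,6)] j(6)] g_cell j(1)] by simp
      also have "\<dots> = (comp_con F (g, init Z) \<star>\<^bsub>H\<^esub> Id2 H h)
          \<cdot>\<^bsub>H\<^esub> (Id2 H (on_arr F g) \<star>\<^bsub>H\<^esub> comp_con F (f, init Y) \<star>\<^bsub>H\<^esub> Id2 H h)"
        using H.hcomp_assoc[OF h H.comp1_hom[OF i(4,6)] j(6) Ih i(1) H.hom1_id2[OF j(6)]] by simp
      \<comment> \<open>From here on only identities are inserted, to match what the constant source
        contributes: its 1-cells are \<open>Id1 H X\<close> and its compositors are identity
        2-cells.\<close>
      also have "\<dots> = Id2 H (on_arr F (init V) \<odot>\<^bsub>H\<^esub> h) \<cdot>\<^bsub>H\<^esub> (comp_con F (g, init Z) \<star>\<^bsub>H\<^esub> Id2 H h)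
          \<cdot>\<^bsub>H\<^esub> (Id2 H (on_arr F g) \<star>\<^bsub>H\<^esub> comp_con F (f, init Y) \<star>\<^bsub>H\<^esub> Id2 H h)"
        using H.vcomp_id_left[OF H.vcomp_hom[OF H.whisker_hom[OF _ j(6) cell_hom[OF f]] cell_hom[OF g]]]
          H.comp1_hom[OF Fh[OF i(9)] i(6)] by simp
      also have "Id2 H (on_arr F (init V) \<odot>\<^bsub>H\<^esub> h)
          = Id2 H (on_arr F (init V) \<odot>\<^bsub>H\<^esub> h) \<star>\<^bsub>H\<^esub> Id2 H (Id1 H X)"
        using H.hcomp_id_right[OF Fh[OF j(10)] H.hom1_id2[OF Fh[OF j(10)]]] by simp
      also have "Id2 H (Id1 H X) = comp_con (const_psf S H X) (g, f)"
        using c by (simp add: const_psf_def strict_psf_def)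
      also have "comp_con F (g, init Z) \<star>\<^bsub>H\<^esub> Id2 H h
          = (comp_con F (g, init Z) \<star>\<^bsub>H\<^esub> Id2 H h) \<star>\<^bsub>H\<^esub> Id2 H (Id1 H X)"
        using H.hcomp_id_right[OF H.comp1_hom[OF Fh[OF j(9)] j(6)] cell_hom[OF g]] by simp
      finally show ?thesis
        by (simp add: cell[OF f] cell[OF g] comp[OF j(10)] const1[OF i(7)])
    qed
    show "ncell (extend1 h) (Id1 S Y) \<cdot>\<^bsub>H\<^esub> (unit_con F Y \<star>\<^bsub>H\<^esub> Id2 H (ncomp (extend1 h) Y))
        = Id2 H (ncomp (extend1 h) Y) \<star>\<^bsub>H\<^esub> unit_con (const_psf S H X) Y" if Y: "Y \<in> Obj S" for Y
    proof -
      have f: "Id1 S Y \<in> Hom1 S Y Y"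
        using S.id1_hom[OF Y] .
      note i = comp_con_init[OF f]
      have FY: "Id1 H (on_obj F Y) \<in> Hom1 H (on_obj F Y) (on_obj F Y)"
        using H.id1_hom[OF obj_map[OF Y]] .
      have "ncell (extend1 h) (Id1 S Y) \<cdot>\<^bsub>H\<^esub> (unit_con F Y \<star>\<^bsub>H\<^esub> Id2 H (ncomp (extend1 h) Y))
          = (comp_con F (Id1 S Y, init Y) \<star>\<^bsub>H\<^esub> Id2 H h)
            \<cdot>\<^bsub>H\<^esub> ((unit_con F Y \<star>\<^bsub>H\<^esub> Id2 H (on_arr F (init Y))) \<star>\<^bsub>H\<^esub> Id2 H h)"
        by (simp add: cell[OF f] comp[OF Y] whisker_split[OF Y FY unit_con_hom[OF Y]])
      also have "\<dots> = (comp_con F (Id1 S Y, init Y) \<cdot>\<^bsub>H\<^esub> (unit_con F Y \<star>\<^bsub>H\<^esub> Id2 H (on_arr F (init Y)))) \<star>\<^bsub>H\<^esub> Id2 H h"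
        using vcomp_h[OF H.comp1_hom[OF i(4) FY]
            H.hcomp_hom[OF i(4) FY H.hom1_id2[OF i(4)] unit_con_hom[OF Y]] i(1)] .
      also have "\<dots> = Id2 H (on_arr F (init Y) \<odot>\<^bsub>H\<^esub> h)"
        by (simp add: unit_left_coherence[OF init_hom[OF Y]] id_split[OF Y])
      also have "\<dots> = Id2 H (on_arr F (init Y) \<odot>\<^bsub>H\<^esub> h) \<star>\<^bsub>H\<^esub> Id2 H (Id1 H X)"
        using H.hcomp_id_right[OF Fh[OF Y] H.hom1_id2[OF Fh[OF Y]]] by simp
      also have "Id2 H (Id1 H X) = unit_con (const_psf S H X) Y"
        using Y by (simp add: const_psf_def strict_psf_def)
      finally show ?thesis
        by (simp add: comp[OF Y])
    qed
  qed
qed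

text \<open>The modification axiom at \<open>f\<close> is the exchange law for
  \<open>\<sigma>\<close> and the compositor at \<open>(f, init Y)\<close>.\<close>

lemma modification_extend2:
  assumes h: "h \<in> Hom1 H X (on_obj F z)" and \<sigma>: "\<sigma> \<in> Hom2 H h h'"
  shows "modification S H (extend2 \<sigma>)"
proof -
  have h': "h' \<in> Hom1 H X (on_obj F z)"
    using H.hom2_tgt[OF \<sigma> h] .
  have D: "Dom H h = X" "Dom H h' = X"
    using h h' by (simp_all add: Hom1_def)
  have [simp]: "msrc (extend2 \<sigma>) = extend1 h" "mtgt (extend2 \<sigma>) = extend1 h'"
    using \<sigma> by (simp_all add: extend2_def Hom2_def)
  have mod: "mcomp (extend2 \<sigma>) Y = Id2 H (on_arr F (init Y)) \<star>\<^bsub>H\<^esub> \<sigma>" if "Y \<in> Obj S" for Y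
    using that by (simp add: extend2_def)
  show ?thesis
  proof (intro modification.intro modification_axioms.intro,
      simp_all only: \<open>msrc (extend2 \<sigma>) = extend1 h\<close> \<open>mtgt (extend2 \<sigma>) = extend1 h'\<close>)
    show "pseudonatural S H (extend1 h)" "pseudonatural S H (extend1 h')"
      using pseudonatural_extend1 h h' by blast+
    show "nsrc (extend1 h') = nsrc (extend1 h)" "ntgt (extend1 h') = ntgt (extend1 h)"
      by (simp_all add: extend1_def D)
    show "mcomp (extend2 \<sigma>) \<in> extensional (Obj S)"
      by (simp add: extend2_def)
    show "mcomp (extend2 \<sigma>) Y \<in> Hom2 H (ncomp (extend1 h) Y) (ncomp (extend1 h') Y)" if Y: "Y \<in> Obj S" for Y
      using H.whisker_hom[OF h arr_map[OF init_hom[OF Y]] \<sigma>] Y by (simp add: mod extend1_def)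
    show "ncell (extend1 h') f \<cdot>\<^bsub>H\<^esub> (Id2 H (on_arr (ntgt (extend1 h)) f) \<star>\<^bsub>H\<^esub> mcomp (extend2 \<sigma>) Y)
        = (mcomp (extend2 \<sigma>) Z \<star>\<^bsub>H\<^esub> Id2 H (on_arr (nsrc (extend1 h)) f)) \<cdot>\<^bsub>H\<^esub> ncell (extend1 h) f"
      if f: "f \<in> Hom1 S Y Z" for f Y Z
    proof -
      note i = comp_con_init[OF f]
      have "ncell (extend1 h') f \<cdot>\<^bsub>H\<^esub> (Id2 H (on_arr F f) \<star>\<^bsub>H\<^esub> mcomp (extend2 \<sigma>) Y)
          = (comp_con F (f, init Y) \<star>\<^bsub>H\<^esub> Id2 H h') \<cdot>\<^bsub>H\<^esub> (Id2 H (on_arr F f \<odot>\<^bsub>H\<^esub> on_arr F (init Y)) \<star>\<^bsub>H\<^esub> \<sigma>)"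
        using i(7,8,9) by (simp add: extend1_def mod H.whisker_comp[OF h \<sigma> i(4,6)])
      also have "\<dots> = (Id2 H (on_arr F (init Z)) \<star>\<^bsub>H\<^esub> \<sigma>) \<cdot>\<^bsub>H\<^esub> (comp_con F (f, init Y) \<star>\<^bsub>H\<^esub> Id2 H h)"
        using H.whisker_exchange[OF h \<sigma> H.comp1_hom[OF i(4,6)] i(1)] .
      also have "Id2 H (on_arr F (init Z)) \<star>\<^bsub>H\<^esub> \<sigma> = (Id2 H (on_arr F (init Z)) \<star>\<^bsub>H\<^esub> \<sigma>) \<star>\<^bsub>H\<^esub> Id2 H (Id1 H X)"
        using H.hcomp_id_right[OF H.comp1_hom[OF h i(5)] H.whisker_hom[OF h i(5) \<sigma>]] by simp
      finally show ?thesis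
        using i(7,8,10) by (simp add: extend1_def mod D const_psf_def strict_psf_def)
    qed
  qed
qed

lemma extend1_hom:
  assumes "h \<in> Hom1 H X (on_obj F z)"
  shows "extend1 h \<in> Hom1 (PS S H) (const_psf S H X) F"
proof -
  have "nsrc (extend1 h) = const_psf S H X" "ntgt (extend1 h) = F"
    using assms by (simp_all add: extend1_def Hom1_def)
  with pseudonatural_extend1[OF assms] show ?thesis
    by (simp add: Hom1_PS)
qed

lemma extend2_hom:
  assumes "h \<in> Hom1 H X (on_obj F z)" "\<sigma> \<in> Hom2 H h h'"
  shows "extend2 \<sigma> \<in> Hom2 (PS S H) (extend1 h) (extend1 h')"
proof -
  have "msrc (extend2 \<sigma>) = extend1 h" "mtgt (extend2 \<sigma>) = extend1 h'"
    using assms(2) by (simp_all add: extend2_def Hom2_def)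
  with modification_extend2[OF assms] show ?thesis
    by (simp add: Hom2_PS)
qed

text \<open>The invertible square of \<open>\<beta>\<close> at \<open>init Y\<close> turns
  whiskering with \<open>\<beta>\<close> at \<open>z\<close>, followed by \<open>G (init Y)\<close>,
  into whiskering the extension with \<open>\<beta>\<close> at \<open>Y\<close>. An equation at
  \<open>z\<close> thus spreads to every object, and faithfulness of \<open>\<beta>\<close> applies
  to the extended 2-cells.\<close>

lemma faithful1_component_at_initial:
  assumes PS: "two_category (PS S H)" and \<beta>: "\<beta> \<in> Hom1 (PS S H) F G" and faithful: "faithful1 (PS S H) \<beta>"
  shows "faithful1 H (ncomp \<beta> z)"
proof (rule H.faithful1I[OF ncomp_PS_hom[OF \<beta> init_obj]])
  fix X h h' \<sigma> \<sigma>'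
  assume h: "h \<in> Hom1 H X (on_obj F z)" and \<sigma>: "\<sigma> \<in> Hom2 H h h'" "\<sigma>' \<in> Hom2 H h h'"
    and eq: "Id2 H (ncomp \<beta> z) \<star>\<^bsub>H\<^esub> \<sigma> = Id2 H (ncomp \<beta> z) \<star>\<^bsub>H\<^esub> \<sigma>'"
  interpret PS: two_category "PS S H" by (rule PS)
  interpret \<beta>: pseudonatural S H \<beta>
    using \<beta> by (simp add: Hom1_PS)
  have \<beta>_src: "nsrc \<beta> = F" and \<beta>_tgt: "ntgt \<beta> = G"
    using \<beta> by (simp_all add: Hom1_PS)
  interpret G: pseudofunctor S H G
    using \<beta>.tgt.pseudofunctor_axioms by (simp add: \<beta>_tgt)
  note w = PS.whisker_hom[OF extend1_hom[OF h] \<beta>]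
  have "Id2 (PS S H) \<beta> \<star>\<^bsub>PS S H\<^esub> extend2 \<sigma> = Id2 (PS S H) \<beta> \<star>\<^bsub>PS S H\<^esub> extend2 \<sigma>'"
  proof (rule PS_cell_eqI[OF w[OF extend2_hom[OF h \<sigma>(1)]] w[OF extend2_hom[OF h \<sigma>(2)]]])
    fix Y assume Y: "Y \<in> Obj S"
    have z: "ncomp \<beta> z \<in> Hom1 H (on_obj F z) (on_obj G z)"
      using ncomp_PS_hom[OF \<beta> init_obj] .
    have \<beta>Y: "ncomp \<beta> Y \<in> Hom1 H (on_obj F Y) (on_obj G Y)"
      using ncomp_PS_hom[OF \<beta> Y] .
    have F: "on_arr F (init Y) \<in> Hom1 H (on_obj F z) (on_obj F Y)"
      using arr_map[OF init_hom[OF Y]] .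
    have G: "on_arr G (init Y) \<in> Hom1 H (on_obj G z) (on_obj G Y)"
      using G.arr_map[OF init_hom[OF Y]] .
    have cell: "ncell \<beta> (init Y)
        \<in> Hom2 H (on_arr G (init Y) \<odot>\<^bsub>H\<^esub> ncomp \<beta> z) (ncomp \<beta> Y \<odot>\<^bsub>H\<^esub> on_arr F (init Y))"
      using \<beta>.ncell_hom[OF init_hom[OF Y]] by (simp add: \<beta>_src \<beta>_tgt)
    have iso: "iso2 H (ncell \<beta> (init Y))"
      using \<beta>.ncell_iso init_hom[OF Y] by (simp add: Hom1_def)
    have "Id2 H (on_arr G (init Y) \<odot>\<^bsub>H\<^esub> ncomp \<beta> z) \<star>\<^bsub>H\<^esub> \<sigma> = Id2 H (on_arr G (init Y) \<odot>\<^bsub>H\<^esub> ncomp \<beta> z) \<star>\<^bsub>H\<^esub> \<sigma>'"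
      by (simp add: H.whisker_comp[OF h \<sigma>(1) z G] H.whisker_comp[OF h \<sigma>(2) z G] eq)
    then have "Id2 H (ncomp \<beta> Y \<odot>\<^bsub>H\<^esub> on_arr F (init Y)) \<star>\<^bsub>H\<^esub> \<sigma> = Id2 H (ncomp \<beta> Y \<odot>\<^bsub>H\<^esub> on_arr F (init Y)) \<star>\<^bsub>H\<^esub> \<sigma>'"
      using H.whisker_eq_iso[OF iso cell H.comp1_hom[OF z G] h \<sigma>] by blast
    then show "mcomp (Id2 (PS S H) \<beta> \<star>\<^bsub>PS S H\<^esub> extend2 \<sigma>) Y = mcomp (Id2 (PS S H) \<beta> \<star>\<^bsub>PS S H\<^esub> extend2 \<sigma>') Y"
      using Y by (simp add: mcomp_PS_whisker[OF Y] extend2_def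
          H.whisker_comp[OF h \<sigma>(1) F \<beta>Y] H.whisker_comp[OF h \<sigma>(2) F \<beta>Y])
  qed
  then have "extend2 \<sigma> = extend2 \<sigma>'"
    using PS.faithful1D[OF faithful \<beta> extend1_hom[OF h] extend2_hom[OF h \<sigma>(1)] extend2_hom[OF h \<sigma>(2)]] by blast
  then have "mcomp (extend2 \<sigma>) z = mcomp (extend2 \<sigma>') z"
    by simp
  \<comment> \<open>The component of \<open>extend2 \<sigma>\<close> at \<open>z\<close> is
    \<open>\<sigma>\<close> whiskered with the image of an identity 1-cell; the unit constraint of
    \<open>F\<close> removes this image.\<close>
  moreover have "init z = Id1 S z"
    using S.id1_hom[OF init_obj] init_hom1[OF init_obj] by simp
  ultimately have "Id2 H (on_arr F (Id1 S z)) \<star>\<^bsub>H\<^esub> \<sigma> = Id2 H (on_arr F (Id1 S z)) \<star>\<^bsub>H\<^esub> \<sigma>'"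
    using init_obj by (simp add: extend2_def)
  then have "Id2 H (Id1 H (on_obj F z)) \<star>\<^bsub>H\<^esub> \<sigma> = Id2 H (Id1 H (on_obj F z)) \<star>\<^bsub>H\<^esub> \<sigma>'"
    using H.whisker_eq_iso[OF unit_con_iso[OF init_obj] unit_con_hom[OF init_obj]
        H.id1_hom[OF obj_map[OF init_obj]] h \<sigma>] by blast
  then show "\<sigma> = \<sigma>'"
    by (simp add: H.hcomp_id_left[OF h \<sigma>(1)] H.hcomp_id_left[OF h \<sigma>(2)])
qed

end


section \<open>Descent\<close>

text \<open>Underlying functions are extensional, so on the empty ordinal the only one is undefined
  everywhere. Local discreteness leaves only the identity 2-cell.\<close>

lemma Delta_dot_initial:
  shows "0 \<in> Obj Delta_dot"
    and "Hom1 Delta_dot 0 n = {(0, n, \<lambda>_. undefined)}"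
    and "Hom2 Delta_dot (0, n, \<lambda>_. undefined) (0, n, \<lambda>_. undefined) = {Id2 Delta_dot (0, n, \<lambda>_. undefined)}"
  by (auto simp: Delta_dot_def locally_discrete_def fin_ord_cat_def Hom1_def Hom2_def mono_on_def)

theorem theorem8p2:
  fixes H :: "('o, 'a, 'c) twocat"
    and A B :: "(nat, ordmap, ordmap, 'o, 'a, 'c) psfun"
    and \<alpha> :: "(nat, ordmap, ordmap, 'o, 'a, 'c) psnat"
  assumes "two_category H"
    and "(UNIV :: nat set) \<prec> (UNIV :: 'u set)"
    and "bicategorically_complete TYPE('u) H"
    and "is_PsRan_j H R \<eta> \<epsilon> s t"
    and "pseudofunctor Delta_dot H A"
    and "pseudofunctor Delta_dot H B"
    and "\<alpha> \<in> Hom1 (PS Delta_dot H) A B"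
  shows "(objectwise_faithful Delta_dot H \<alpha> \<and> almost_j_descent H \<eta> B
            \<longrightarrow> almost_j_descent H \<eta> A) \<and>
         (objectwise_fully_faithful Delta_dot H \<alpha> \<and> j_descent H \<eta> B
            \<longrightarrow> j_descent H \<eta> A)"
proof -
  define L where "L = precomp Delta Delta_dot H j_incl"
  have biadj: "biadjunction (PS Delta_dot H) (PS Delta H) L R \<eta> \<epsilon> s t"
    using assms(4) by (simp add: is_PsRan_j_def L_def)
  interpret H: two_category H by fact
  \<comment> \<open>The 2-category laws for both pseudofunctor 2-categories are clauses of
    \<open>biadjunction\<close>.\<close>
  interpret K: two_category "PS Delta_dot H" using biadj by (simp add: biadjunction_def)
  interpret M: two_category "PS Delta H" using biadj by (simp add: biadjunction_def)
  interpret L: pseudofunctor "PS Delta_dot H" "PS Delta H" L using biadj by (simp add: biadjunction_def)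
  interpret R: pseudofunctor "PS Delta H" "PS Delta_dot H" R using biadj by (simp add: biadjunction_def)
  have \<eta>: "\<eta> \<in> Hom1 (PS (PS Delta_dot H) (PS Delta_dot H)) (psf_id (PS Delta_dot H))
      (psf_comp (PS Delta_dot H) (PS Delta_dot H) R L)"
    using biadj by (simp add: biadjunction_def)
  interpret \<eta>: pseudonatural "PS Delta_dot H" "PS Delta_dot H" \<eta>
    using \<eta> by (simp add: Hom1_PS)
  have \<eta>_src: "nsrc \<eta> = psf_id (PS Delta_dot H)"
    and \<eta>_tgt: "ntgt \<eta> = psf_comp (PS Delta_dot H) (PS Delta_dot H) R L"
    using \<eta> by (simp_all add: Hom1_PS)
  have A: "A \<in> Obj (PS Delta_dot H)" and B: "B \<in> Obj (PS Delta_dot H)"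
    using assms(5,6) by (simp_all add: PS_def)
  note \<alpha> = assms(7)
  have \<alpha>A: "\<alpha> \<in> Arr (PS Delta_dot H)"
    using \<alpha> by (simp add: Hom1_def)
  define RL\<alpha> where "RL\<alpha> = on_arr R (on_arr L \<alpha>)"
  have RL\<alpha>: "RL\<alpha> \<in> Hom1 (PS Delta_dot H) (on_obj R (on_obj L A)) (on_obj R (on_obj L B))"
    unfolding RL\<alpha>_def by (rule R.arr_map[OF L.arr_map[OF \<alpha>]])
  have \<eta>A: "ncomp \<eta> A \<in> Hom1 (PS Delta_dot H) A (on_obj R (on_obj L A))"
    using \<eta>.ncomp_hom[OF A] A by (simp add: \<eta>_src \<eta>_tgt psf_comp_def psf_id_def strict_psf_def)
  have \<eta>B: "ncomp \<eta> B \<in> Hom1 (PS Delta_dot H) B (on_obj R (on_obj L B))"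
    using \<eta>.ncomp_hom[OF B] B by (simp add: \<eta>_src \<eta>_tgt psf_comp_def psf_id_def strict_psf_def)
  \<comment> \<open>The 1-cell \<open>\<alpha>\<close> is itself a transformation, so the square of
    \<eta> at it is an invertible modification; its component at 0 is the required 2-cell of
    \<open>H\<close>.\<close>
  have \<eta>\<alpha>: "ncell \<eta> \<alpha> \<in> Hom2 (PS Delta_dot H) (RL\<alpha> \<odot>\<^bsub>PS Delta_dot H\<^esub> ncomp \<eta> A)
      (ncomp \<eta> B \<odot>\<^bsub>PS Delta_dot H\<^esub> \<alpha>)"
    using \<eta>.ncell_hom[OF \<alpha>] \<alpha>A by (simp add: RL\<alpha>_def \<eta>_src \<eta>_tgt psf_comp_def psf_id_def strict_psf_def)
  note 0 = Delta_dot_initial(1)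
  note a0 = ncomp_PS_hom[OF \<alpha> 0] and \<eta>A0 = ncomp_PS_hom[OF \<eta>A 0]
    and \<eta>B0 = ncomp_PS_hom[OF \<eta>B 0] and RL\<alpha>0 = ncomp_PS_hom[OF RL\<alpha> 0]
  have square: "mcomp (ncell \<eta> \<alpha>) 0
      \<in> Hom2 H (ncomp RL\<alpha> 0 \<odot>\<^bsub>H\<^esub> ncomp (ncomp \<eta> A) 0) (ncomp (ncomp \<eta> B) 0 \<odot>\<^bsub>H\<^esub> ncomp \<alpha> 0)"
    using mcomp_PS_hom[OF \<eta>\<alpha> 0] by (simp add: ncomp_PS_comp[OF 0])
  have "iso2 H (mcomp (ncell \<eta> \<alpha>) 0)"
    by (rule iso2_mcomp[OF \<eta>.ncell_iso[OF \<alpha>A] \<eta>\<alpha> 0])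
  \<comment> \<open>The inverse is taken because faithfulness is known for the composite through
    \<open>B\<close> and has to reach the composite whose right factor belongs to
    \<open>A\<close>.\<close>
  with square obtain \<omega> where \<omega>: "iso2 H \<omega>"
    "\<omega> \<in> Hom2 H (ncomp (ncomp \<eta> B) 0 \<odot>\<^bsub>H\<^esub> ncomp \<alpha> 0) (ncomp RL\<alpha> 0 \<odot>\<^bsub>H\<^esub> ncomp (ncomp \<eta> A) 0)"
    by (blast elim: iso2E)
  have RL\<alpha>0_faithful: "faithful1 H (ncomp RL\<alpha> 0)" if "objectwise_faithful Delta_dot H \<alpha>"
  proof -
    have L\<alpha>: "on_arr L \<alpha> \<in> Hom1 (PS Delta H) (on_obj L A) (on_obj L B)"
      using L.arr_map[OF \<alpha>] .
    have "ncomp (on_arr L \<alpha>) n = ncomp \<alpha> n" if "n \<in> Obj Delta" for n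
      using that \<alpha>A by (simp add: L_def precomp_def strict_psf_def whisker_right_def j_incl_def)
    moreover have "faithful1 H (ncomp \<alpha> n)" for n
      using that by (simp add: objectwise_faithful_def Delta_dot_def locally_discrete_def fin_ord_cat_def)
    ultimately have "faithful1 (PS Delta H) (on_arr L \<alpha>)"
      using objectwise_faithful_imp_faithful1_PS[OF M.two_category_axioms H.two_category_axioms L\<alpha>] by simp
    then have faithful: "faithful1 (PS Delta_dot H) RL\<alpha>"
      unfolding RL\<alpha>_def by (rule right_biadjoint_faithful1[OF biadj L\<alpha>])
    have "on_obj R (on_obj L A) \<in> Obj (PS Delta_dot H)"
      by (intro R.obj_map L.obj_map A)
    then have "pseudofunctor Delta_dot H (on_obj R (on_obj L A))"
      by (simp add: PS_def)
    \<comment> \<open>Cancellation concerns 1-cells into the source of \<open>RL\<alpha>\<close>, so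
      this source is the pseudofunctor along which they are extended.\<close>
    then interpret psf_at_initial Delta_dot H "on_obj R (on_obj L A)" 0 "\<lambda>n. (0, n, \<lambda>_. undefined)"
      by (intro psf_at_initial.intro psf_at_initial_axioms.intro Delta_dot_initial)
    show ?thesis
      by (rule faithful1_component_at_initial[OF K.two_category_axioms RL\<alpha> faithful])
  qed
  have "almost_j_descent H \<eta> A" if "objectwise_faithful Delta_dot H \<alpha>" "almost_j_descent H \<eta> B"
  proof -
    have "faithful1 H (ncomp (ncomp \<eta> B) 0 \<odot>\<^bsub>H\<^esub> ncomp \<alpha> 0)"
      using H.faithful1_comp[OF _ a0 _ \<eta>B0] that 0 by (simp add: objectwise_faithful_def almost_j_descent_def)
    then show ?thesis
      using H.faithful1_right_factor[OF H.faithful1_iso[OF _ H.comp1_hom[OF a0 \<eta>B0] \<omega>] \<eta>A0 RL\<alpha>0]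
      by (simp add: almost_j_descent_def)
  qed
  moreover have "j_descent H \<eta> A" if ff: "objectwise_fully_faithful Delta_dot H \<alpha>" and "j_descent H \<eta> B"
  proof -
    have "fully_faithful1 H (ncomp (ncomp \<eta> B) 0 \<odot>\<^bsub>H\<^esub> ncomp \<alpha> 0)"
      using H.fully_faithful1_comp[OF _ a0 _ \<eta>B0] that 0
      by (simp add: objectwise_fully_faithful_def j_descent_def)
    \<comment> \<open>Fullness has entered through the component at 0; the remaining ordinals
      contribute faithfulness, by way of \<open>RL\<alpha>0_faithful\<close>.\<close>
    moreover have "objectwise_faithful Delta_dot H \<alpha>"
      using ff H.fully_faithful1_faithful
      by (auto simp: objectwise_faithful_def objectwise_fully_faithful_def)
    ultimately show ?thesis
      using H.fully_faithful1_right_factor[OF H.fully_faithful1_iso[OF _ H.comp1_hom[OF a0 \<eta>B0] \<omega>] \<eta>A0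
          RL\<alpha>0_faithful RL\<alpha>0]
      by (simp add: j_descent_def)
  qed
  ultimately show ?thesis by blast
qed

end
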